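(* Let $X,Y$ be real separable Banach spaces and let $\mu$ be a Gaussian measure on the Borel $\sigma$-algebra $\mathcal{B}(X)$ with mean element $m_\mu\in X$ and covariance operator $C_\mu:X^*\to X$. Let $G:X\to Y$ be a bounded linear operator. Suppose that the operator $C_\nu := GC_\mu G^*:Y^*\to Y$ has finite rank $p$. Then there exist a continuous affine map $\tilde m_\mu:Y\to X$, a symmetric positive operator $\tilde C_\mu:X^*\to X$ and a disintegration $(\mu_{|G=y})_{y\in Y}$ of $\mu$ with respect to $G$ such that for each $y\in Y$ the measure $\mu_{|G=y}$ is Gaussian with mean element $\tilde m_\mu(y)$ and covariance operator $\tilde C_\mu$. Furthermore, for any $C_\nu$-representing sequence $y_i^*$, $i=1,\dots,p$, the mean and covariance are equal to $$\tilde m_\mu(y) = m_\mu+\sum_{i=1}^{p}\langle y-Gm_\mu,y_i^*\rangle\, C_\mu G^*y_i^*,$$ $$\tilde C_\mu = C_\mu-\sum_{i=1}^{p}\langle C_\mu G^*y_i^*,\,\cdot\,\rangle\, C_\mu G^*y_i^* .$$ The mean element also satisfies $G\tilde m_\mu(y)=y$ for all $y\in Y_0:=Gm_\mu+C_\nu(Y^* )$.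
   Context: For a Banach space $X$, $f\in X$, $g^*\in X^*$, write $\langle f,g^*\rangle=g^*(f)$; $G^*:Y^*\to X^*$ is the adjoint of $G$. A Gaussian measure on a separable Banach space $X$ is a Borel probability measure all of whose pushforwards by continuous linear functionals are Gaussian (possibly degenerate) on $\mathbb{R}$. Its mean element is the unique $m_\mu\in X$ with $\int_X\langle f,g^*\rangle d\mu(f)=\langle m_\mu,g^*\rangle$ for all $g^*\in X^*$; its covariance operator is the linear operator $C_\mu:X^*\to X$ with $\langle C_\mu g_1^*,g_2^*\rangle=\int_X(\langle f,g_1^*\rangle-\langle m_\mu,g_1^*\rangle)(\langle f,g_2^*\rangle-\langle m_\mu,g_2^*\rangle)\,d\mu(f)$ for all $g_1^*,g_2^*\in X^*$. An operator $R:X^*\to X$ is symmetric positive if it is linear with $\langle Rf^*,g^*\rangle=\langle Rg^*,f^*\rangle$ and $\langle Rf^*,f^*\rangle\ge0$ for all $f^*,g^*\in X^*$. For such $R$, a family $(x_i^* )_{i\in I}$ in $X^*$ is $R$-representing if $\langle Rx_i^*,x_j^*\rangle=\delta_{ij}$ for all $i,j\in I$ and $\sum_{i\in I}\langle Rx_i^*,x^*\rangle^2=\langle Rx^*,x^*\rangle$ for all $x^*\in X^*$. Given measurable spaces $(X,\mathcal{A})$, $(Y,\mathcal{C})$, a probability measure $\mu$ on $X$ and a measurable map $G:X\to Y$, a disintegration of $\mu$ with respect to $G$ is a map $\tilde\mu:\mathcal{A}\times Y\to[0,1]$, written $\mu_{|G=y}(\cdot):=\tilde\mu(\cdot,y)$,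 such that: 1. for each $y\in Y$, $\tilde\mu(\cdot,y)$ is a probability measure on $X$, and for each $A\in\mathcal{A}$ the function $\tilde\mu(A,\cdot)$ is $\mathcal{C}$-measurable; 2. there exists a set in $\mathcal{C}$ of full $\mu\circ G^{-1}$-measure such that for all $y$ in it, $\{y\}\in\mathcal{C}$ and $\tilde\mu(G^{-1}(\{y\}),y)=1$; 3. $\mu(A)=\int_Y\tilde\mu(A,y)\,d(\mu\circ G^{-1})(y)$ for all $A\in\mathcal{A}$. Banach spaces carry their Borel $\sigma$-algebras.
   Formalization: Off Y_0 the mean formula depends on the representing sequence, so no single mean map equals it for all sequences; proved: one covariance for all sequences, the mean equals the formula on Y_0, and each sequence's formula on all of Y is the mean of some Gaussian disintegration. *)

theory Defs
  imports "HOL-Probability.Probability"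
begin

text \<open>
  Conventions. A real separable Banach space is a type of class \<open>banach\<close> and
  \<open>second_countable_topology\<close> (for metric spaces, second countable is the same as separable).
  The dual \<open>X\<^sup>*\<close> of \<open>X = 'a\<close> is the type \<open>'a \<Rightarrow>\<^sub>L real\<close> of bounded linear functionals, and \<open>\<langle>f, g\<rangle>\<close>
  is the value of the functional \<open>g\<close> at \<open>f\<close>.
\<close>

abbreviation dual_pairing :: "'a::real_normed_vector \<Rightarrow> ('a \<Rightarrow>\<^sub>L real) \<Rightarrow> real" ("\<langle>_, _\<rangle>") where
  "\<langle>f, g\<rangle> \<equiv> blinfun_apply g f"

definition banach_adjoint ::
  "('a::real_normed_vector \<Rightarrow>\<^sub>L 'b::real_normed_vector) \<Rightarrow> ('b \<Rightarrow>\<^sub>L real) \<Rightarrow> ('a \<Rightarrow>\<^sub>L real)" where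
  "banach_adjoint G g = g o\<^sub>L G"

definition gaussian_real :: "real measure \<Rightarrow> bool" where
  "gaussian_real N \<longleftrightarrow>
     (\<exists>m. N = return borel m) \<or>
     (\<exists>m \<sigma>. \<sigma> > 0 \<and> N = density lborel (\<lambda>x. ennreal (normal_density m \<sigma> x)))"

definition gaussian_measure :: "'a::{banach, second_countable_topology} measure \<Rightarrow> bool" where
  "gaussian_measure M \<longleftrightarrow>
     sets M = sets borel \<and> prob_space M \<and>
     (\<forall>g. gaussian_real (distr M borel (\<lambda>f. \<langle>f, g\<rangle>)))"

text \<open>
  The mean element and the covariance operator are given as predicates. The integrability
  conditions exclude the default value 0 of the Bochner integral; they hold automatically for
  Gaussian measures. The mean element is unique because the dual separates points.
\<close>

definition mean_element :: "'a::{banach, second_countable_topology} measure \<Rightarrow> 'a \<Rightarrow> bool" where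
  "mean_element M m \<longleftrightarrow>
     (\<forall>g. integrable M (\<lambda>f. \<langle>f, g\<rangle>) \<and> (LINT f|M. \<langle>f, g\<rangle>) = \<langle>m, g\<rangle>)"

definition covariance_operator ::
  "'a::{banach, second_countable_topology} measure \<Rightarrow> (('a \<Rightarrow>\<^sub>L real) \<Rightarrow> 'a) \<Rightarrow> bool" where
  "covariance_operator M C \<longleftrightarrow>
     linear C \<and>
     (\<exists>m. mean_element M m \<and>
        (\<forall>g1 g2.
           integrable M (\<lambda>f. (\<langle>f, g1\<rangle> - \<langle>m, g1\<rangle>) * (\<langle>f, g2\<rangle> - \<langle>m, g2\<rangle>)) \<and>
           \<langle>C g1, g2\<rangle> = (LINT f|M. (\<langle>f, g1\<rangle> - \<langle>m, g1\<rangle>) * (\<langle>f, g2\<rangle> - \<langle>m, g2\<rangle>))))"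

definition symmetric_positive :: "(('a::real_normed_vector \<Rightarrow>\<^sub>L real) \<Rightarrow> 'a) \<Rightarrow> bool" where
  "symmetric_positive R \<longleftrightarrow>
     linear R \<and>
     (\<forall>f g. \<langle>R f, g\<rangle> = \<langle>R g, f\<rangle>) \<and>
     (\<forall>f. \<langle>R f, f\<rangle> \<ge> 0)"

definition representing ::
  "(('a::real_normed_vector \<Rightarrow>\<^sub>L real) \<Rightarrow> 'a) \<Rightarrow> 'i set \<Rightarrow> ('i \<Rightarrow> 'a \<Rightarrow>\<^sub>L real) \<Rightarrow> bool" where
  "representing R I x \<longleftrightarrow>
     (\<forall>i\<in>I. \<forall>j\<in>I. \<langle>R (x i), x j\<rangle> = (if i = j then 1 else 0)) \<and>
     (\<forall>g. ((\<lambda>i. \<langle>R (x i), g\<rangle>\<^sup>2) has_sum \<langle>R g, g\<rangle>) I)"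

text \<open>
  The first conjunct excludes infinite-dimensional ranges, for which \<open>dim\<close> is 0 by convention.
\<close>

definition has_finite_rank :: "('a::real_vector \<Rightarrow> 'b::real_vector) \<Rightarrow> nat \<Rightarrow> bool" where
  "has_finite_rank T p \<longleftrightarrow> (\<exists>B. finite B \<and> range T \<subseteq> span B) \<and> dim (range T) = p"

definition continuous_affine :: "('a::real_normed_vector \<Rightarrow> 'b::real_normed_vector) \<Rightarrow> bool" where
  "continuous_affine T \<longleftrightarrow> continuous_on UNIV T \<and> linear (\<lambda>x. T x - T 0)"

text \<open>
  A disintegration of \<open>M\<close> with respect to \<open>G\<close>, with values in the measurable space \<open>N\<close>, is a family
  \<open>K y\<close> of probability measures on the same sigma-algebra as \<open>M\<close>.
\<close>

definition disintegration ::
  "'a measure \<Rightarrow> 'b measure \<Rightarrow> ('a \<Rightarrow> 'b) \<Rightarrow> ('b \<Rightarrow> 'a measure) \<Rightarrow> bool" where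
  "disintegration M N G K \<longleftrightarrow>
     (\<forall>y\<in>space N. sets (K y) = sets M \<and> prob_space (K y)) \<and>
     (\<forall>A\<in>sets M. (\<lambda>y. measure (K y) A) \<in> borel_measurable N) \<and>
     (\<exists>S\<in>sets N. measure (distr M N G) S = 1 \<and>
        (\<forall>y\<in>S. {y} \<in> sets N \<and> measure (K y) (G -` {y} \<inter> space M) = 1)) \<and>
     (\<forall>A\<in>sets M. measure M A = (LINT y|distr M N G. measure (K y) A))"


definition gaussian_disintegration ::
  "'a::{banach, second_countable_topology} measure \<Rightarrow> ('a \<Rightarrow>\<^sub>L 'b::{banach, second_countable_topology}) \<Rightarrow>
   ('b \<Rightarrow> 'a) \<Rightarrow> (('a \<Rightarrow>\<^sub>L real) \<Rightarrow> 'a) \<Rightarrow> ('b \<Rightarrow> 'a measure) \<Rightarrow> bool" where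
  "gaussian_disintegration M G m C K \<longleftrightarrow>
     continuous_affine m \<and>
     symmetric_positive C \<and>
     disintegration M borel (blinfun_apply G) K \<and>
     (\<forall>y. gaussian_measure (K y) \<and> mean_element (K y) (m y) \<and> covariance_operator (K y) C)"

text \<open>
  The two formulas below depend on a family \<open>ys\<close> in the dual of the codomain of \<open>G\<close>. When \<open>ys\<close> runs over the
  representing families of \<open>\<lambda>g. G (C (banach_adjoint G g))\<close>, the covariance does not depend on \<open>ys\<close>, but
  the mean does, off the affine subspace \<open>G m + range (\<lambda>g. G (C (banach_adjoint G g)))\<close>: a representing family is determined
  by the operator only up to elements of its kernel (for \<open>diag(1,0)\<close> on the plane, \<open>(1, a)\<close> is
  representing for every \<open>a\<close>).
\<close>

definition conditional_mean ::
  "('a::real_normed_vector \<Rightarrow>\<^sub>L 'b::real_normed_vector) \<Rightarrow> 'a \<Rightarrow> (('a \<Rightarrow>\<^sub>L real) \<Rightarrow> 'a) \<Rightarrow>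
   nat \<Rightarrow> (nat \<Rightarrow> 'b \<Rightarrow>\<^sub>L real) \<Rightarrow> 'b \<Rightarrow> 'a" where
  "conditional_mean G m C p ys y =
     m + (\<Sum>i=1..p. \<langle>y - blinfun_apply G m, ys i\<rangle> *\<^sub>R C (banach_adjoint G (ys i)))"

definition conditional_covariance ::
  "('a::real_normed_vector \<Rightarrow>\<^sub>L 'b::real_normed_vector) \<Rightarrow> (('a \<Rightarrow>\<^sub>L real) \<Rightarrow> 'a) \<Rightarrow>
   nat \<Rightarrow> (nat \<Rightarrow> 'b \<Rightarrow>\<^sub>L real) \<Rightarrow> ('a \<Rightarrow>\<^sub>L real) \<Rightarrow> 'a" where
  "conditional_covariance G C p ys f =
     C f - (\<Sum>i=1..p. \<langle>C (banach_adjoint G (ys i)), f\<rangle> *\<^sub>R C (banach_adjoint G (ys i)))"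

end

theory Submission
  imports Defs
begin

text \<open>
  Fix a representing family \<open>y\<^sub>1, \<dots>, y\<^sub>p\<close> of \<open>C\<^sub>\<nu> = G C G\<^sup>*\<close> and let \<open>L z = (\<Sum>i. \<langle>z, y\<^sub>i\<rangle> C G\<^sup>* y\<^sub>i)\<close>, the linear part of the
  conditional mean. A Gaussian vector splits as \<open>x = L (G x) + U x\<close> with \<open>U = 1 - L G\<close>. The prediction error
  \<open>U x\<close> is uncorrelated with \<open>G x\<close>, hence independent of it, so conditioning on \<open>G x = y\<close> freezes the first
  summand and leaves the law of the second unchanged: the conditional measure is the law of \<open>U x + L y\<close>. It is an
  affine image of a Gaussian measure, and its mean and covariance are those in the theorem. Moreover \<open>G (U x)\<close>
  has covariance zero, so it is almost surely constant; this puts the conditional measure on the fibre over \<open>y\<close>.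
  These arguments are collected in \<open>gaussian_disintegration_conditional\<close>.

  Three ingredients carry the proof.

  \<^item> That uncorrelated parts are independent is shown by comparing characteristic functionals
  (\<open>gaussian_independent_sum\<close>), which requires that finite Borel measures on a separable normed space be
  determined by them (\<open>finite_measure_eq_if_transform_eq\<close>). This is reduced to Levy's theorem on the line: the
  functionals are treated one at a time, the other ones entering through trigonometric weights.

  \<^item> The reduction needs enough functionals to generate the Borel sets. They come from the Hahn-Banach theorem
  (\<open>norming_functional_exists\<close>), obtained from the fact that minimal sublinear functionals are linear.

  \<^item> Representing families of length \<open>p\<close> exist by Gram-Schmidt for the semi-inner product
  \<open>\<langle>C\<^sub>\<nu> g, h\<rangle>\<close> (\<open>representing_family_exists\<close>). Functionals of seminorm zero are annihilated by \<open>C G\<^sup>*\<close>, so \<open>L\<close> agrees with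
  \<open>C\<^sub>\<nu> g \<mapsto> C G\<^sup>* g\<close> on the range of \<open>C\<^sub>\<nu>\<close> (\<open>gain_image_covariance\<close>). This yields \<open>G (m y) = y\<close> on \<open>Y\<^sub>0\<close> and shows that
  neither the conditional mean on \<open>Y\<^sub>0\<close> nor the conditional covariance depends on the family.
\<close>

section \<open>The Hahn-Banach theorem by minimal sublinear functionals\<close>

definition sublinear :: "('a::real_vector \<Rightarrow> real) \<Rightarrow> bool" where
  "sublinear q \<longleftrightarrow> (\<forall>x y. q (x + y) \<le> q x + q y) \<and> (\<forall>c\<ge>0. \<forall>x. q (c *\<^sub>R x) = c * q x)"

lemma sublinear_add: "sublinear q \<Longrightarrow> q (x + y) \<le> q x + q y"
  and sublinear_scale: "sublinear q \<Longrightarrow> c \<ge> 0 \<Longrightarrow> q (c *\<^sub>R x) = c * q x"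
  by (auto simp: sublinear_def)

lemma sublinear_zero: "sublinear q \<Longrightarrow> q 0 = 0"
  using sublinear_scale[of q 0 0] by simp

lemma sublinear_norm: "sublinear norm"
  by (auto simp: sublinear_def norm_triangle_ineq)

lemma sublinear_minus_ge: "sublinear q \<Longrightarrow> - q (- x) \<le> q x"
  using sublinear_add[of q x "- x"] sublinear_zero[of q] by simp

text \<open>
  The largest sublinear functional below \<open>q\<close> whose value at \<open>- z\<close> is at most \<open>- q z\<close>: any such \<open>r\<close> has
  \<open>r y \<le> r (y + t *\<^sub>R z) + t * r (- z) \<le> q (y + t *\<^sub>R z) - t * q z\<close> for all \<open>t \<ge> 0\<close>. It makes \<open>q\<close> as close to odd in
  the direction \<open>z\<close> as sublinearity permits.
\<close>

definition tilt :: "('a::real_vector \<Rightarrow> real) \<Rightarrow> 'a \<Rightarrow> 'a \<Rightarrow> real" where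
  "tilt q z y = (INF t\<in>{0..}. q (y + t *\<^sub>R z) - t * q z)"

text \<open>
  Keeps the infimum defining \<open>tilt\<close> away from the default value of \<open>Inf\<close> on unbounded sets.
\<close>

lemma tilt_bdd:
  assumes "sublinear q"
  shows "bdd_below ((\<lambda>t. q (y + t *\<^sub>R z) - t * q z) ` {0..})"
proof (rule bdd_belowI2)
  fix t :: real assume "t \<in> {0..}"
  then have "t * q z = q (- y + (y + t *\<^sub>R z))"
    using sublinear_scale[OF assms, of t z] by simp
  also have "\<dots> \<le> q (- y) + q (y + t *\<^sub>R z)"
    by (rule sublinear_add[OF assms])
  finally show "- q (- y) \<le> q (y + t *\<^sub>R z) - t * q z" by simp
qed

lemma tilt_le: "sublinear q \<Longrightarrow> t \<ge> 0 \<Longrightarrow> tilt q z y \<le> q (y + t *\<^sub>R z) - t * q z"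
  unfolding tilt_def by (rule cINF_lower[OF tilt_bdd]) auto

lemma tilt_ge: "(\<And>t. t \<ge> 0 \<Longrightarrow> c \<le> q (y + t *\<^sub>R z) - t * q z) \<Longrightarrow> c \<le> tilt q z y"
  unfolding tilt_def by (rule cINF_greatest) auto

lemma tilt_le_self: "sublinear q \<Longrightarrow> tilt q z y \<le> q y"
  using tilt_le[of q 0 z y] by simp

lemma tilt_uminus_le: "sublinear q \<Longrightarrow> tilt q z (- z) \<le> - q z"
  using tilt_le[of q 1 z "- z"] sublinear_zero[of q] by simp

lemma sublinear_tilt:
  assumes q: "sublinear q"
  shows "sublinear (tilt q z)"
  unfolding sublinear_def
proof (intro conjI allI impI)
  fix x y
  have *: "tilt q z (x + y) \<le> (q (x + s *\<^sub>R z) - s * q z) + (q (y + t *\<^sub>R z) - t * q z)"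
    if "s \<ge> 0" "t \<ge> 0" for s t
  proof -
    have "q ((x + y) + (s + t) *\<^sub>R z) \<le> q (x + s *\<^sub>R z) + q (y + t *\<^sub>R z)"
      using sublinear_add[OF q, of "x + s *\<^sub>R z" "y + t *\<^sub>R z"]
      by (simp add: algebra_simps)
    with tilt_le[OF q, of "s + t" z "x + y"] that show ?thesis by (simp add: algebra_simps)
  qed
  have "tilt q z (x + y) - (q (x + s *\<^sub>R z) - s * q z) \<le> tilt q z y" if "s \<ge> 0" for s
    by (rule tilt_ge) (use *[OF that] in \<open>simp add: algebra_simps\<close>)
  then have "tilt q z (x + y) - tilt q z y \<le> tilt q z x"
    by (intro tilt_ge) (simp add: algebra_simps)
  then show "tilt q z (x + y) \<le> tilt q z x + tilt q z y" by simp
next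
  have le: "tilt q z (c *\<^sub>R x) \<le> c * tilt q z x" if "c > 0" for c x
  proof -
    have "tilt q z (c *\<^sub>R x) / c \<le> tilt q z x"
    proof (rule tilt_ge)
      fix t :: real assume "t \<ge> 0"
      with that tilt_le[OF q, of "c * t" z "c *\<^sub>R x"]
      have "tilt q z (c *\<^sub>R x) \<le> q (c *\<^sub>R (x + t *\<^sub>R z)) - c * t * q z"
        by (simp add: algebra_simps)
      also have "\<dots> = c * (q (x + t *\<^sub>R z) - t * q z)"
        using that by (simp add: sublinear_scale[OF q] algebra_simps del: scaleR_add_right)
      finally show "tilt q z (c *\<^sub>R x) / c \<le> q (x + t *\<^sub>R z) - t * q z"
        using that by (simp add: field_simps)
    qed
    with that show ?thesis by (simp add: field_simps)
  qed
  fix c :: real and x assume "0 \<le> c"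
  show "tilt q z (c *\<^sub>R x) = c * tilt q z x"
  proof (cases "c = 0")
    case True
    have "tilt q z 0 = 0"
    proof (rule antisym)
      show "tilt q z 0 \<le> 0"
        using tilt_le_self[OF q, of z 0] sublinear_zero[OF q] by simp
      show "0 \<le> tilt q z 0"
        by (rule tilt_ge) (simp add: sublinear_scale[OF q])
    qed
    with True show ?thesis by simp
  next
    case False
    with \<open>0 \<le> c\<close> have "c > 0" by simp
    then have "c * tilt q z x \<le> tilt q z (c *\<^sub>R x)"
      using le[of "1 / c" "c *\<^sub>R x"] by (simp add: field_simps)
    with le[OF \<open>c > 0\<close>, of x] show ?thesis by simp
  qed
qed

text \<open>
  Tilting a minimal \<open>q\<close> in any direction returns \<open>q\<close> itself, so \<open>q (- x) \<le> - q x\<close>. Hence \<open>q\<close> is odd, and an odd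
  sublinear functional is also superadditive and homogeneous for negative scalars.
\<close>

lemma minimal_sublinear_linear:
  assumes q: "sublinear q"
    and min: "\<And>q'. sublinear q' \<Longrightarrow> (\<And>x. q' x \<le> q x) \<Longrightarrow> q' = q"
  shows "linear q"
proof -
  have odd: "q (- x) = - q x" for x
  proof (rule antisym)
    have "tilt q x = q"
      by (rule min[OF sublinear_tilt[OF q] tilt_le_self[OF q]])
    then show "q (- x) \<le> - q x" using tilt_uminus_le[OF q, of x] by simp
    show "- q x \<le> q (- x)" using sublinear_minus_ge[OF q, of x] by simp
  qed
  show ?thesis
  proof (rule linearI)
    fix x y
    have "- q (x + y) \<le> - q x - q y"
      using sublinear_add[OF q, of "- x" "- y"] odd[of "x + y"] odd[of x] odd[of y] by simp
    with sublinear_add[OF q, of x y] show "q (x + y) = q x + q y" by simp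
  next
    fix c :: real and x
    show "q (c *\<^sub>R x) = c *\<^sub>R q x"
    proof (cases "c \<ge> 0")
      case True
      then show ?thesis by (simp add: sublinear_scale[OF q])
    next
      case False
      then have "q ((- c) *\<^sub>R x) = - c * q x" by (intro sublinear_scale[OF q]) simp
      with odd[of "c *\<^sub>R x"] show ?thesis by simp
    qed
  qed
qed

text \<open>
  The chain condition is what gives subadditivity: two members \<open>q\<close> and \<open>r\<close> can be replaced by the smaller of
  them before their values at \<open>x\<close> and \<open>y\<close> are added. The common upper bound \<open>p\<close> also bounds the members
  from below, since \<open>q x \<ge> - q (- x) \<ge> - p (- x)\<close>.
\<close>

lemma sublinear_INF_chain:
  fixes S :: "('a::real_vector \<Rightarrow> real) set"
  assumes S: "S \<noteq> {}" "\<And>q. q \<in> S \<Longrightarrow> sublinear q" "\<And>q x. q \<in> S \<Longrightarrow> q x \<le> p x"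
    and chain: "\<And>q q'. q \<in> S \<Longrightarrow> q' \<in> S \<Longrightarrow> q \<le> q' \<or> q' \<le> q"
  shows "sublinear (\<lambda>x. INF q\<in>S. q x)" and "q \<in> S \<Longrightarrow> (INF q\<in>S. q x) \<le> q x"
proof -
  have bdd: "bdd_below ((\<lambda>q. q x) ` S)" for x
  proof (rule bdd_belowI2)
    fix q assume "q \<in> S"
    then show "- p (- x) \<le> q x"
      using sublinear_minus_ge[OF S(2), of q x] S(3)[of q "- x"] by simp
  qed
  let ?u = "\<lambda>x. INF q\<in>S. q x"
  show low: "?u x \<le> q x" if "q \<in> S" for q x
    using that by (rule cINF_lower[OF bdd])
  have ge: "c \<le> ?u x" if "\<And>q. q \<in> S \<Longrightarrow> c \<le> q x" for c x
    using S(1) that by (rule cINF_greatest)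
  show "sublinear ?u"
    unfolding sublinear_def
  proof (intro conjI allI impI)
    fix x y
    have *: "?u (x + y) \<le> q x + r y" if qr: "q \<in> S" "r \<in> S" for q r
    proof -
      obtain s where s: "s \<in> S" "s \<le> q" "s \<le> r"
        using chain[OF qr] qr by blast
      then have "?u (x + y) \<le> s x + s y"
        using low[OF s(1), of "x + y"] sublinear_add[OF S(2)[OF s(1)], of x y] by simp
      also have "\<dots> \<le> q x + r y" using s by (intro add_mono) (auto simp: le_fun_def)
      finally show ?thesis .
    qed
    have "?u (x + y) - q x \<le> ?u y" if "q \<in> S" for q
      by (rule ge) (use *[OF that] in \<open>simp add: algebra_simps\<close>)
    then have "?u (x + y) - ?u y \<le> ?u x" by (intro ge) (simp add: algebra_simps)
    then show "?u (x + y) \<le> ?u x + ?u y" by simp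
  next
    fix c :: real and x assume "0 \<le> c"
    show "?u (c *\<^sub>R x) = c * ?u x"
    proof (cases "c = 0")
      case True
      with S(1) show ?thesis by (simp add: sublinear_zero[OF S(2)])
    next
      case False
      with \<open>0 \<le> c\<close> have c: "c > 0" by simp
      show ?thesis
      proof (rule antisym)
        have "?u (c *\<^sub>R x) / c \<le> ?u x"
          by (rule ge) (use c low[of _ "c *\<^sub>R x"] sublinear_scale[OF S(2), of _ c x] in
            \<open>fastforce simp: field_simps\<close>)
        with c show "?u (c *\<^sub>R x) \<le> c * ?u x" by (simp add: field_simps)
        show "c * ?u x \<le> ?u (c *\<^sub>R x)"
          by (rule ge) (use c low in \<open>simp add: sublinear_scale[OF S(2)]\<close>)
      qed
    qed
  qed
qed

text \<open>
  Zorn's lemma provides a minimal sublinear functional below \<open>p\<close>.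
\<close>

lemma linear_below_sublinear:
  assumes p: "sublinear p"
  obtains q where "linear q" "\<And>x. q x \<le> p x"
proof -
  let ?A = "{q. sublinear q \<and> (\<forall>x. q x \<le> p x)}"
  let ?P = "\<lambda>q r :: 'a \<Rightarrow> real. r \<le> q"
  have "\<exists>m\<in>?A. \<forall>a\<in>?A. ?P m a \<longrightarrow> a = m"
  proof (rule predicate_Zorn)
    show "partial_order_on ?A (relation_of ?P ?A)"
      by (rule partial_order_on_relation_ofI) auto
  next
    fix S assume "S \<in> Chains (relation_of ?P ?A)"
    then have S: "q \<in> S \<Longrightarrow> sublinear q" "q \<in> S \<Longrightarrow> q x \<le> p x"
        "q \<in> S \<Longrightarrow> r \<in> S \<Longrightarrow> q \<le> r \<or> r \<le> q" for q r x
      unfolding Chains_def relation_of_def by fast+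
    show "\<exists>u\<in>?A. \<forall>a\<in>S. ?P a u"
    proof (cases "S = {}")
      case True
      with p show ?thesis by auto
    next
      case False
      let ?u = "\<lambda>x. INF q\<in>S. q x"
      have u: "sublinear ?u" "\<And>q x. q \<in> S \<Longrightarrow> ?u x \<le> q x"
        using sublinear_INF_chain[of S p] False S by blast+
      obtain q0 where q0: "q0 \<in> S" using False by blast
      have "?u \<in> ?A"
        using u(1) u(2)[OF q0] S(2)[OF q0] by (fastforce intro: order_trans)
      moreover have "\<forall>a\<in>S. ?u \<le> a" using u(2) by (auto simp: le_fun_def)
      ultimately show ?thesis by blast
    qed
  qed
  then obtain m where m: "sublinear m" "\<And>x. m x \<le> p x"
      "\<And>a. sublinear a \<Longrightarrow> (\<And>x. a x \<le> p x) \<Longrightarrow> a \<le> m \<Longrightarrow> a = m"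
    by blast
  have "linear m"
    by (rule minimal_sublinear_linear[OF m(1)])
       (metis le_funI m(2,3) order_trans)
  with m(2) that show thesis by blast
qed

text \<open>
  The Hahn-Banach theorem in the form of a supporting functional. Tilting the norm in the direction \<open>x\<close> before
  choosing a linear functional below it forces the value at \<open>x\<close> to be as large as possible.
\<close>

theorem norming_functional_exists:
  fixes x :: "'a::real_normed_vector"
  obtains g :: "'a \<Rightarrow>\<^sub>L real" where "\<And>y. \<bar>\<langle>y, g\<rangle>\<bar> \<le> norm y" "\<langle>x, g\<rangle> = norm x"
proof -
  obtain q :: "'a \<Rightarrow> real" where q: "linear q" "\<And>y. q y \<le> tilt norm x y"
    using linear_below_sublinear[OF sublinear_tilt[OF sublinear_norm]] by blast
  interpret linear q by (rule q)
  have le: "q y \<le> norm y" for y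
    using q(2) tilt_le_self[OF sublinear_norm] by (rule order_trans)
  have abs: "\<bar>q y\<bar> \<le> norm y" for y
    using le[of y] le[of "- y"] by (simp add: neg)
  have "q (- x) \<le> - norm x"
    using q(2) tilt_uminus_le[OF sublinear_norm] by (rule order_trans)
  with le[of x] have eq: "q x = norm x" by (simp add: neg)
  have "bounded_linear q"
    by (rule bounded_linear_intro[of _ 1]) (use abs in \<open>auto simp: add scaleR\<close>)
  then have "blinfun_apply (Blinfun q) = q" by (rule bounded_linear_Blinfun_apply)
  with abs eq that[of "Blinfun q"] show thesis by simp
qed

lemma dual_separates_points:
  fixes x y :: "'a::real_normed_vector"
  assumes "\<And>g :: 'a \<Rightarrow>\<^sub>L real. \<langle>x, g\<rangle> = \<langle>y, g\<rangle>"
  shows "x = y"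
proof -
  obtain g :: "'a \<Rightarrow>\<^sub>L real" where "\<langle>x - y, g\<rangle> = norm (x - y)"
    using norming_functional_exists by blast
  with assms[of g] show ?thesis by (simp add: blinfun.diff_right)
qed

text \<open>
  One supporting functional for each point of a countable dense set is enough: for \<open>d\<close> near \<open>x\<close>, its supporting
  functional takes at \<open>x\<close> a value near \<open>norm d\<close>, hence near \<open>norm x\<close>.
\<close>

lemma countable_norming_set:
  obtains g :: "nat \<Rightarrow> 'a::{real_normed_vector, second_countable_topology} \<Rightarrow>\<^sub>L real"
  where "\<And>x r. norm x \<le> r \<longleftrightarrow> (\<forall>n. \<langle>x, g n\<rangle> \<le> r)"
proof -
  obtain D :: "'a set" where D: "countable D" "\<And>X. open X \<Longrightarrow> X \<noteq> {} \<Longrightarrow> \<exists>d\<in>D. d \<in> X"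
    using countable_dense_setE by metis
  then have "D \<noteq> {}" by (metis UNIV_not_empty empty_iff open_UNIV)
  then have rD: "range (from_nat_into D) = D" using D(1) by (rule range_from_nat_into)
  have "\<forall>n. \<exists>h :: 'a \<Rightarrow>\<^sub>L real. (\<forall>y. \<bar>\<langle>y, h\<rangle>\<bar> \<le> norm y) \<and>
      \<langle>from_nat_into D n, h\<rangle> = norm (from_nat_into D n)"
    by (metis norming_functional_exists)
  then obtain g :: "nat \<Rightarrow> 'a \<Rightarrow>\<^sub>L real" where g: "\<And>n y. \<bar>\<langle>y, g n\<rangle>\<bar> \<le> norm y"
      "\<And>n. \<langle>from_nat_into D n, g n\<rangle> = norm (from_nat_into D n)"
    by metis
  have "norm x \<le> r" if *: "\<And>n. \<langle>x, g n\<rangle> \<le> r" for x r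
  proof (rule field_le_epsilon)
    fix e :: real assume "e > 0"
    then obtain d where d: "d \<in> D" "d \<in> ball x (e / 2)"
      using D(2)[of "ball x (e / 2)"] by auto
    then obtain n where n: "d = from_nat_into D n" using rD by blast
    have dx: "norm (d - x) < e / 2" using d(2) by (simp add: dist_norm norm_minus_commute)
    have "\<langle>d, g n\<rangle> - \<langle>x, g n\<rangle> \<le> norm (d - x)"
      using g(1)[of n "d - x"] by (simp add: blinfun.diff_right)
    moreover have "norm x \<le> norm d + norm (d - x)"
      using norm_triangle_ineq2[of x d] by (simp add: norm_minus_commute)
    ultimately show "norm x \<le> r + e" using *[of n] g(2)[of n] dx n by simp
  qed
  moreover have "\<langle>x, g n\<rangle> \<le> norm x" for x n using g(1)[of n x] by simp
  ultimately show thesis using that[of g] by (meson order_trans)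
qed

section \<open>Uniqueness of measures with a given characteristic functional\<close>

lemma blinfun_apply_borel[measurable]:
  fixes g :: "'a::real_normed_vector \<Rightarrow>\<^sub>L 'b::real_normed_vector"
  shows "blinfun_apply g \<in> borel_measurable borel"
  by (intro borel_measurable_continuous_onI linear_continuous_on blinfun.bounded_linear_right)

text \<open>
  A countable norming set of functionals exhibits every closed ball as a countable intersection of half-spaces;
  by the Lindelof property, balls generate all open sets.
\<close>

lemma borel_eq_sigma_halfspaces:
  "(borel :: 'a::{real_normed_vector, second_countable_topology} measure) =
     sigma UNIV (range (\<lambda>(g, r). {x. \<langle>x, g\<rangle> \<le> r}))"
    (is "_ = sigma UNIV ?H")
proof -
  define S where "S = sigma UNIV ?H"
  have UNIV_S: "UNIV \<in> sets S" by (simp add: S_def sigma_sets_top)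
  obtain g :: "nat \<Rightarrow> 'a \<Rightarrow>\<^sub>L real" where g: "\<And>x r. norm x \<le> r \<longleftrightarrow> (\<forall>n. \<langle>x, g n\<rangle> \<le> r)"
    using countable_norming_set by blast
  have half: "{x. \<langle>x, h\<rangle> \<le> r} \<in> sets S" for h r
    unfolding S_def by (auto intro!: image_eqI[of _ _ "(h, r)"])
  have cball: "cball a r \<in> sets S" for a r
  proof -
    have "cball a r = (\<Inter>n. {x. \<langle>x, g n\<rangle> \<le> r + \<langle>a, g n\<rangle>})"
      using g[of "_ - a" r]
      by (auto simp: dist_norm norm_minus_commute blinfun.diff_right algebra_simps)
    also have "\<dots> \<in> sets S" using UNIV_S half by (intro sets.countable_INT'') auto
    finally show ?thesis .
  qed
  have ball: "ball a r \<in> sets S" for a r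
  proof -
    have "ball a r = (\<Union>n. cball a (r - inverse (real (Suc n))))"
    proof (intro set_eqI iffI)
      fix x assume "x \<in> ball a r"
      then obtain n where "inverse (real (Suc n)) < r - dist a x"
        using reals_Archimedean[of "r - dist a x"] by auto
      then have "x \<in> cball a (r - inverse (real (Suc n)))" by simp
      then show "x \<in> (\<Union>n. cball a (r - inverse (real (Suc n))))" by blast
    next
      fix x assume "x \<in> (\<Union>n. cball a (r - inverse (real (Suc n))))"
      then obtain n where "dist a x \<le> r - inverse (real (Suc n))" by auto
      moreover have "inverse (real (Suc n)) > 0" by simp
      ultimately show "x \<in> ball a r" unfolding mem_ball by linarith
    qed
    then show ?thesis using cball by auto
  qed
  have "open U \<Longrightarrow> U \<in> sets S" for U
  proof -
    assume U: "open U"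
    let ?F = "{ball a r | a r. ball a r \<subseteq> U}"
    obtain F where F: "F \<subseteq> ?F" "countable F" "\<Union>F = \<Union>?F"
      using Lindelof[of ?F] by auto
    have "\<Union>?F = U" using U unfolding open_contains_ball
      by (auto intro!: centre_in_ball[THEN iffD2]) (metis centre_in_ball)
    moreover have "\<Union>F \<in> sets S" using F(1,2) ball by (intro sets.countable_Union) auto
    ultimately show ?thesis using F(3) by simp
  qed
  then have "sets (borel :: 'a measure) \<subseteq> sets S"
    unfolding borel_def using sets.sigma_sets_subset[of "{U. open U}" S]
    by (auto simp: S_def)
  moreover have "sets S \<subseteq> sets (borel :: 'a measure)"
  proof -
    have "{x :: 'a. \<langle>x, h\<rangle> \<le> r} \<in> sets borel" for h r by measurable
    then show ?thesis
      unfolding S_def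
      by (subst sets_measure_of) (auto intro!: sets.sigma_sets_subset[of _ borel, simplified])
  qed
  ultimately have "sets (borel :: 'a measure) = sets S" by blast
  then show ?thesis
    by (intro measure_eqI) (auto simp: borel_def emeasure_sigma S_def)
qed

text \<open>
  Levy's uniqueness theorem for probability measures, after division by the common total mass \<open>char P 0\<close>.
\<close>

lemma finite_measure_eq_if_char_eq:
  fixes P Q :: "real measure"
  assumes P: "finite_measure P" "sets P = sets borel"
    and Q: "finite_measure Q" "sets Q = sets borel"
    and char: "\<And>t. char P t = char Q t"
  shows "P = Q"
proof -
  interpret P: finite_measure P by fact
  interpret Q: finite_measure Q by fact
  have sp: "space P = UNIV" "space Q = UNIV"
    using sets_eq_imp_space_eq[OF P(2)] sets_eq_imp_space_eq[OF Q(2)] by auto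
  define c where "c = measure P UNIV"
  have cQ: "measure Q UNIV = c"
    using char[of 0] sp by (simp add: char_def c_def)
  have eP: "emeasure P UNIV = ennreal c" and eQ: "emeasure Q UNIV = ennreal c"
    using P.emeasure_eq_measure Q.emeasure_eq_measure cQ by (auto simp: c_def)
  show ?thesis
  proof (cases "c = 0")
    case True
    have "emeasure P A = emeasure Q A" if "A \<in> sets P" for A
    proof -
      have "emeasure P A \<le> emeasure P UNIV" "emeasure Q A \<le> emeasure Q UNIV"
        using P(2) Q(2) that by (auto intro!: emeasure_mono)
      with eP eQ True show ?thesis by simp
    qed
    with P(2) Q(2) show ?thesis by (auto intro: measure_eqI)
  next
    case False
    then have c: "c > 0" using c_def measure_nonneg[of P UNIV] by linarith
    define D where "D R = density R (\<lambda>_. ennreal (1 / c))" for R :: "real measure"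
    have eD: "emeasure (D R) A = ennreal (1 / c) * emeasure R A"
      if "sets R = sets borel" "A \<in> sets borel" for R A
      unfolding D_def by (rule emeasure_density_const) (use that in simp)
    have one: "ennreal (1 / c) * ennreal c = 1"
      using c by (simp flip: ennreal_mult')
    have dist: "real_distribution (D R)"
      if "sets R = sets borel" "emeasure R UNIV = ennreal c" for R
    proof -
      have "sets (D R) = sets borel" using that by (simp add: D_def)
      moreover have "space (D R) = UNIV"
        using sets_eq_imp_space_eq[OF that(1)] by (simp add: D_def)
      ultimately show ?thesis
        using one that
        by (auto simp: real_distribution_def real_distribution_axioms_def eD intro!: prob_spaceI)
    qed
    have chD: "char (D R) t = char R t / c" if [measurable_cong]: "sets R = sets borel" for R t
      unfolding char_def D_def using c
      by (subst integral_density) (auto simp: scaleR_conv_of_real)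
    have "D P = D Q"
      using dist[OF P(2) eP] dist[OF Q(2) eQ]
      by (rule Levy_uniqueness) (auto simp: chD P Q char)
    have "emeasure P A = emeasure Q A" if "A \<in> sets P" for A
    proof -
      have "ennreal c * emeasure (D P) A = ennreal c * emeasure (D Q) A"
        using \<open>D P = D Q\<close> by simp
      then show ?thesis
        using one P(2) Q(2) that by (simp add: eD mult.assoc[symmetric] mult.commute)
    qed
    with P(2) Q(2) show ?thesis by (auto intro: measure_eqI)
  qed
qed

text \<open>
  One-dimensional uniqueness applied to the image under \<open>f\<close> of the measure with density \<open>w\<close>. The weight carries
  along the information on other functionals in the induction over coordinates that follows.
\<close>

lemma weighted_char_determines_law:
  fixes f w :: "'a \<Rightarrow> real"
  assumes M: "finite_measure M" and N: "finite_measure N" and MN: "sets M = sets N"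
    and f[measurable]: "f \<in> borel_measurable N"
    and w[measurable]: "w \<in> borel_measurable N"
    and w0: "\<And>x. 0 \<le> w x" and wK: "\<And>x. w x \<le> K"
    and char: "\<And>t. (CLINT x|M. w x *\<^sub>R iexp (t * f x)) = (CLINT x|N. w x *\<^sub>R iexp (t * f x))"
    and B[measurable]: "B \<in> sets borel"
  shows "(LINT x|M. w x * indicator B (f x)) = (LINT x|N. w x * indicator B (f x))"
proof -
  define P where "P R = distr (density R (\<lambda>x. ennreal (w x))) borel f" for R
  have *: "finite_measure (P R)" "\<And>t. char (P R) t = (CLINT x|R. w x *\<^sub>R iexp (t * f x))"
    "measure (P R) B = (LINT x|R. w x * indicator B (f x))"
    if "finite_measure R" and [measurable_cong]: "sets R = sets N" for R
  proof -
    interpret R: finite_measure R by fact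
    have "(\<integral>\<^sup>+x. ennreal (w x) \<partial>R) \<le> (\<integral>\<^sup>+x. ennreal K \<partial>R)"
      using wK by (intro nn_integral_mono) (auto intro: ennreal_leI)
    also have "\<dots> < \<infinity>" by (simp add: R.emeasure_eq_measure ennreal_mult_less_top)
    finally have "(\<integral>\<^sup>+x. ennreal (w x) \<partial>R) \<noteq> \<infinity>" by simp
    then show fin: "finite_measure (P R)"
      unfolding P_def by (intro finite_measure.finite_measure_distr finite_measureI)
        (auto simp: emeasure_density cong: nn_integral_cong)
    show "char (P R) t = (CLINT x|R. w x *\<^sub>R iexp (t * f x))" for t
      unfolding char_def P_def
      by (subst integral_distr, simp, simp, subst integral_density) (auto simp: w0)
    have "measure (P R) B = (LINT x|P R. indicator B x)" by (simp add: P_def)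
    also have "\<dots> = (LINT x|R. w x * indicator B (f x))"
      unfolding P_def
      by (subst integral_distr, simp, simp, subst integral_density) (auto simp: w0)
    finally show "measure (P R) B = (LINT x|R. w x * indicator B (f x))" .
  qed
  have "P M = P N"
    by (rule finite_measure_eq_if_char_eq)
      (use *(1,2)[OF M MN] *(1,2)[OF N refl] char in \<open>auto simp: P_def\<close>)
  with *(3)[OF M MN] *(3)[OF N refl] show ?thesis by simp
qed

text \<open>
  The induction from one dimension to a Banach space is over events: an event \<open>E\<close> qualifies when the
  measures restricted to \<open>E\<close> have the same characteristic functional, not only the same mass. This stronger
  property is what can be propagated to \<open>E \<inter> S\<close> for a further half-space \<open>S\<close>.
\<close>

definition same_transform_on ::
  "'a::{real_normed_vector, second_countable_topology} measure \<Rightarrow> 'a measure \<Rightarrow> 'a set \<Rightarrow> bool" where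
  "same_transform_on M N E \<longleftrightarrow> E \<in> sets borel \<and>
     (\<forall>h. (CLINT x|M. indicator E x *\<^sub>R iexp \<langle>x, h\<rangle>) = (CLINT x|N. indicator E x *\<^sub>R iexp \<langle>x, h\<rangle>))"

lemma integrable_weighted_iexp:
  assumes "finite_measure M" and [measurable_cong]: "sets M = sets N"
    and [measurable]: "w \<in> borel_measurable N" "f \<in> borel_measurable N"
    and wK: "\<And>x. \<bar>w x :: real\<bar> \<le> K"
  shows "integrable M (\<lambda>x. w x *\<^sub>R iexp (f x))"
  by (rule finite_measure.integrable_const_bound[OF assms(1), where B = K])
    (use wK in \<open>auto simp: norm_exp_i_times\<close>)

text \<open>
  The one-dimensional uniqueness theorem needs nonnegative weights, so \<open>iexp \<langle>x, h\<rangle>\<close> is replaced by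
  \<open>1 + cos (\<langle>x, h\<rangle> + c)\<close> on \<open>E\<close>. Multiplying this weight by \<open>iexp (t * \<langle>x, g\<rangle>)\<close> gives a combination of characters at
  \<open>t *\<^sub>R g\<close> and \<open>t *\<^sub>R g \<plusminus> h\<close>, whose integrals over \<open>E\<close> agree by hypothesis. So the weighted laws of \<open>\<langle>x, g\<rangle>\<close>
  agree, and the phases \<open>c = 0, \<pi>, \<plusminus> \<pi>/2\<close> recover cosine and sine of \<open>\<langle>x, h\<rangle>\<close> over \<open>E \<inter> {x. \<langle>x, g\<rangle> \<in> B}\<close>.
\<close>

lemma same_transform_on_Int_halfspace:
  fixes M N :: "'a::{real_normed_vector, second_countable_topology} measure"
  assumes M: "finite_measure M" "sets M = sets borel" and N: "finite_measure N" "sets N = sets borel"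
    and E: "same_transform_on M N E" and B[measurable]: "B \<in> sets borel"
  shows "same_transform_on M N (E \<inter> {x. \<langle>x, g\<rangle> \<in> B})"
proof -
  have [measurable]: "E \<in> sets borel" using E by (simp add: same_transform_on_def)
  have EB[measurable]: "E \<inter> {x. \<langle>x, g\<rangle> \<in> B} \<in> sets borel" by measurable
  define ind :: "'a \<Rightarrow> real" where "ind = indicator (E \<inter> {x. \<langle>x, g\<rangle> \<in> B})"
  have ind_meas[measurable]: "ind \<in> borel_measurable borel" unfolding ind_def by measurable
  have ind_bound: "\<bar>ind x\<bar> \<le> 1" for x by (simp add: ind_def indicator_def)
  define F where "F k x = indicator E x *\<^sub>R iexp \<langle>x, k\<rangle>" for k x
  define e where "e R k = (CLINT x|R. F k x)" for R k
  have e: "e M k = e N k" for k using E by (simp add: same_transform_on_def e_def F_def)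
  define w where "w h c x = indicator E x * (1 + cos (\<langle>x, h\<rangle> + c))" for h c x
  have [measurable]: "w h c \<in> borel_measurable borel" for h c unfolding w_def by measurable
  have w0: "0 \<le> w h c x" for h c x
    unfolding w_def
    by (intro mult_nonneg_nonneg) (simp, use cos_ge_minus_one[of "\<langle>x, h\<rangle> + c"] in linarith)
  have w2: "w h c x \<le> 2" for h c x
  proof -
    have "1 + cos (\<langle>x, h\<rangle> + c) \<le> 2" using cos_le_one[of "\<langle>x, h\<rangle> + c"] by linarith
    then show ?thesis by (simp add: w_def indicator_def)
  qed
  have split: "(CLINT x|R. w h c x *\<^sub>R iexp (t * \<langle>x, g\<rangle>)) =
      e R (t *\<^sub>R g) + (iexp c * e R (t *\<^sub>R g + h) + iexp (- c) * e R (t *\<^sub>R g - h)) / 2"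
    if "finite_measure R" "sets R = sets borel" for R h c t
  proof -
    have int: "integrable R (F k)" for k
      unfolding F_def by (rule integrable_weighted_iexp[OF that, where K = 1]) (auto simp: indicator_def)
    have "w h c x *\<^sub>R iexp (t * \<langle>x, g\<rangle>) =
        F (t *\<^sub>R g) x + (iexp c * F (t *\<^sub>R g + h) x + iexp (- c) * F (t *\<^sub>R g - h) x) / 2" for x
    proof -
      have "complex_of_real (cos (\<langle>x, h\<rangle> + c)) =
          (iexp c * iexp \<langle>x, h\<rangle> + iexp (- c) * iexp (- \<langle>x, h\<rangle>)) / 2"
        by (simp only: cos_of_real[symmetric] cos_exp_eq)
          (simp add: distrib_left exp_add[symmetric] algebra_simps)
      moreover have "iexp \<langle>x, t *\<^sub>R g + h\<rangle> = iexp \<langle>x, t *\<^sub>R g\<rangle> * iexp \<langle>x, h\<rangle>"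
          "iexp \<langle>x, t *\<^sub>R g - h\<rangle> = iexp \<langle>x, t *\<^sub>R g\<rangle> * iexp (- \<langle>x, h\<rangle>)"
        by (simp_all add: blinfun.add_left blinfun.diff_left distrib_left right_diff_distrib
            flip: exp_add)
      moreover have "of_real (k * (1 + C)) * u = k * u + (a * (k * (u * b)) + a' * (k * (u * b'))) / 2"
        if "of_real C = (a * b + a' * b') / 2" for k C :: real and u a b a' b' :: complex
        by (simp add: that add_divide_distrib algebra_simps)
      ultimately show ?thesis
        by (simp add: w_def F_def scaleR_conv_of_real blinfun.scaleR_left del: of_real_mult of_real_add)
    qed
    then show ?thesis
      using int by (simp add: e_def)
  qed
  have eq: "(LINT x|M. ind x * (1 + cos (\<langle>x, h\<rangle> + c))) =
      (LINT x|N. ind x * (1 + cos (\<langle>x, h\<rangle> + c)))" for h c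
  proof -
    have "(LINT x|M. w h c x * indicator B \<langle>x, g\<rangle>) = (LINT x|N. w h c x * indicator B \<langle>x, g\<rangle>)"
    proof (rule weighted_char_determines_law[OF M(1) N(1) _ _ _ w0 w2 _ B])
      show "sets M = sets N" using M N by simp
      show "blinfun_apply g \<in> borel_measurable N" "w h c \<in> borel_measurable N"
        using N(2) by (simp_all cong: measurable_cong_sets)
      show "(CLINT x|M. w h c x *\<^sub>R iexp (t * \<langle>x, g\<rangle>)) =
          (CLINT x|N. w h c x *\<^sub>R iexp (t * \<langle>x, g\<rangle>))" for t
        by (simp only: split[OF M] split[OF N] e)
    qed
    moreover have "w h c x * indicator B \<langle>x, g\<rangle> = ind x * (1 + cos (\<langle>x, h\<rangle> + c))" for x
      by (auto simp: w_def ind_def indicator_def)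
    ultimately show ?thesis by simp
  qed
  have *: "(CLINT x|R. ind x *\<^sub>R iexp \<langle>x, h\<rangle>) =
      of_real ((LINT x|R. ind x * (1 + cos (\<langle>x, h\<rangle> + 0))) / 2 -
               (LINT x|R. ind x * (1 + cos (\<langle>x, h\<rangle> + pi))) / 2) +
      \<i> * of_real ((LINT x|R. ind x * (1 + cos (\<langle>x, h\<rangle> + - (pi / 2)))) / 2 -
                   (LINT x|R. ind x * (1 + cos (\<langle>x, h\<rangle> + pi / 2))) / 2)"
    if "finite_measure R" and [measurable_cong]: "sets R = sets borel" for R h
  proof -
    interpret R: finite_measure R by fact
    have int: "integrable R (\<lambda>x. ind x * (1 + cos (\<langle>x, h\<rangle> + c)))" for c
    proof (rule R.integrable_const_bound[where B = 2])
      have "\<bar>ind x * (1 + cos (\<langle>x, h\<rangle> + c))\<bar> \<le> 1 * 2" for x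
      proof -
        have "\<bar>1 + cos (\<langle>x, h\<rangle> + c)\<bar> \<le> 2"
          using cos_ge_minus_one[of "\<langle>x, h\<rangle> + c"] cos_le_one[of "\<langle>x, h\<rangle> + c"] by linarith
        then show ?thesis
          unfolding abs_mult by (intro mult_mono ind_bound) auto
      qed
      then show "AE x in R. norm (ind x * (1 + cos (\<langle>x, h\<rangle> + c))) \<le> 2" by simp
    qed measurable
    have i: "integrable R (\<lambda>x. ind x *\<^sub>R iexp \<langle>x, h\<rangle>)"
      by (rule integrable_weighted_iexp[OF that, where K = 1]) (auto simp: ind_bound)
    have trig: "cos (y + - (pi / 2)) = sin y" "cos (y + pi / 2) = - sin y" for y
      by (simp_all add: cos_add cos_diff)
    show ?thesis
    proof (rule complex_eqI)
      have "Re (CLINT x|R. ind x *\<^sub>R iexp \<langle>x, h\<rangle>) = (LINT x|R. ind x * cos \<langle>x, h\<rangle>)"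
        by (subst integral_Re[OF i, symmetric]) (simp add: Re_exp)
      also have "\<dots> = (LINT x|R. (ind x * (1 + cos (\<langle>x, h\<rangle> + 0))) / 2 -
            (ind x * (1 + cos (\<langle>x, h\<rangle> + pi))) / 2)"
        by (intro Bochner_Integration.integral_cong) (auto simp: field_simps)
      also have "\<dots> = (LINT x|R. ind x * (1 + cos (\<langle>x, h\<rangle> + 0))) / 2 -
               (LINT x|R. ind x * (1 + cos (\<langle>x, h\<rangle> + pi))) / 2"
        using int[of 0] int[of pi] by (subst Bochner_Integration.integral_diff) auto
      finally show "Re (CLINT x|R. ind x *\<^sub>R iexp \<langle>x, h\<rangle>) = Re (of_real (
               (LINT x|R. ind x * (1 + cos (\<langle>x, h\<rangle> + 0))) / 2 -
               (LINT x|R. ind x * (1 + cos (\<langle>x, h\<rangle> + pi))) / 2) +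
      \<i> * of_real ((LINT x|R. ind x * (1 + cos (\<langle>x, h\<rangle> + - (pi / 2)))) / 2 -
                   (LINT x|R. ind x * (1 + cos (\<langle>x, h\<rangle> + pi / 2))) / 2))" by simp
      have "Im (CLINT x|R. ind x *\<^sub>R iexp \<langle>x, h\<rangle>) = (LINT x|R. ind x * sin \<langle>x, h\<rangle>)"
        by (subst integral_Im[OF i, symmetric]) (simp add: Im_exp)
      also have "\<dots> = (LINT x|R. (ind x * (1 + cos (\<langle>x, h\<rangle> + - (pi / 2)))) / 2 -
            (ind x * (1 + cos (\<langle>x, h\<rangle> + pi / 2))) / 2)"
        unfolding trig by (intro Bochner_Integration.integral_cong) (auto simp: field_simps)
      also have "\<dots> = (LINT x|R. ind x * (1 + cos (\<langle>x, h\<rangle> + - (pi / 2)))) / 2 -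
               (LINT x|R. ind x * (1 + cos (\<langle>x, h\<rangle> + pi / 2))) / 2"
        using int[of "- (pi / 2)"] int[of "pi / 2"] by (subst Bochner_Integration.integral_diff) auto
      finally show "Im (CLINT x|R. ind x *\<^sub>R iexp \<langle>x, h\<rangle>) = Im (of_real (
               (LINT x|R. ind x * (1 + cos (\<langle>x, h\<rangle> + 0))) / 2 -
               (LINT x|R. ind x * (1 + cos (\<langle>x, h\<rangle> + pi))) / 2) +
      \<i> * of_real ((LINT x|R. ind x * (1 + cos (\<langle>x, h\<rangle> + - (pi / 2)))) / 2 -
                   (LINT x|R. ind x * (1 + cos (\<langle>x, h\<rangle> + pi / 2))) / 2))" by simp
    qed
  qed
  show ?thesis
    unfolding same_transform_on_def ind_def[symmetric] *[OF M] *[OF N] eq using EB by simp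
qed

lemma same_transform_on_Diff:
  assumes M: "finite_measure M" "sets M = sets borel" and N: "finite_measure N" "sets N = sets borel"
    and E: "same_transform_on M N E" "same_transform_on M N F" "F \<subseteq> E"
  shows "same_transform_on M N (E - F)"
proof -
  have [measurable]: "E \<in> sets borel" "F \<in> sets borel" 
    using E by (auto simp: same_transform_on_def)
  have "(CLINT x|R. indicator (E - F) x *\<^sub>R iexp \<langle>x, h\<rangle>) =
      (CLINT x|R. indicator E x *\<^sub>R iexp \<langle>x, h\<rangle>) - (CLINT x|R. indicator F x *\<^sub>R iexp \<langle>x, h\<rangle>)"
    if "finite_measure R" "sets R = sets borel" for R h
  proof -
    have "integrable R (\<lambda>x. indicator A x *\<^sub>R iexp \<langle>x, h\<rangle>)" if "A \<in> sets borel" for A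
      by (rule integrable_weighted_iexp[OF \<open>finite_measure R\<close> \<open>sets R = sets borel\<close>, where K = 1])
        (use that in \<open>auto simp: indicator_def[abs_def]\<close>)
    then have "(CLINT x|R. indicator E x *\<^sub>R iexp \<langle>x, h\<rangle>) - (CLINT x|R. indicator F x *\<^sub>R iexp \<langle>x, h\<rangle>) =
        (CLINT x|R. indicator E x *\<^sub>R iexp \<langle>x, h\<rangle> - indicator F x *\<^sub>R iexp \<langle>x, h\<rangle>)"
      by (intro Bochner_Integration.integral_diff[symmetric]) auto
    also have "\<dots> = (CLINT x|R. indicator (E - F) x *\<^sub>R iexp \<langle>x, h\<rangle>)"
      using E(3) by (intro Bochner_Integration.integral_cong) (auto simp: indicator_def)
    finally show ?thesis by simp
  qed
  with M N E show ?thesis by (simp add: same_transform_on_def)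
qed

lemma same_transform_on_decreasing_INT:
  assumes M: "finite_measure M" "sets M = sets borel" and N: "finite_measure N" "sets N = sets borel"
    and E: "\<And>n. same_transform_on M N (E n)" "decseq E"
  shows "same_transform_on M N (\<Inter>n. E n)"
proof -
  have [measurable]: "E n \<in> sets borel" for n
    using E by (auto simp: same_transform_on_def)
  have lim: "(\<lambda>n. CLINT x|R. indicator (E n) x *\<^sub>R iexp \<langle>x, h\<rangle>) \<longlonglongrightarrow>
      (CLINT x|R. indicator (\<Inter>n. E n) x *\<^sub>R iexp \<langle>x, h\<rangle>)"
    if "finite_measure R" and [measurable_cong]: "sets R = sets borel" for R h
  proof (rule integral_dominated_convergence[where w = "\<lambda>_. 1"])
    interpret finite_measure R by fact
    show "integrable R (\<lambda>_. 1 :: real)" by simp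
    show "AE x in R. (\<lambda>n. indicator (E n) x *\<^sub>R iexp \<langle>x, h\<rangle>) \<longlonglongrightarrow> indicator (\<Inter>n. E n) x *\<^sub>R iexp \<langle>x, h\<rangle>"
      by (intro AE_I2 tendsto_intros LIMSEQ_indicator_decseq E(2))
    show "AE x in R. norm (indicator (E n) x *\<^sub>R iexp \<langle>x, h\<rangle>) \<le> 1" for n
      by (auto simp: indicator_def)
  qed measurable
  have "(CLINT x|M. indicator (\<Inter>n. E n) x *\<^sub>R iexp \<langle>x, h\<rangle>) =
      (CLINT x|N. indicator (\<Inter>n. E n) x *\<^sub>R iexp \<langle>x, h\<rangle>)" for h
    using lim[OF M, of h] lim[OF N, of h] E(1) 
    by (auto simp: same_transform_on_def intro: LIMSEQ_unique)
  then show ?thesis by (auto simp: same_transform_on_def)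
qed

text \<open>
  The sets \<open>S\<close> such that \<open>E \<inter> S\<close> qualifies whenever \<open>E\<close> does form a sigma-algebra: a countable union is
  handled by removing its members from \<open>E\<close> one after another and passing to the limit. It contains the
  half-spaces, hence every Borel set; then \<open>E = UNIV\<close> and the character at \<open>0\<close> give equality of the masses.
\<close>

theorem finite_measure_eq_if_transform_eq:
  fixes M N :: "'a::{real_normed_vector, second_countable_topology} measure"
  assumes M: "finite_measure M" "sets M = sets borel" and N: "finite_measure N" "sets N = sets borel"
    and eq: "\<And>h. (CLINT x|M. iexp \<langle>x, h\<rangle>) = (CLINT x|N. iexp \<langle>x, h\<rangle>)"
  shows "M = N"
proof -
  let ?good = "same_transform_on M N"
  note diff = same_transform_on_Diff[OF M N]
  have inter: "?good (E \<inter> S)"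
    if "S \<in> sigma_sets UNIV (range (\<lambda>(g, r). {x. \<langle>x, g\<rangle> \<le> r}))" "?good E" for S E
    using that
  proof (induction arbitrary: E)
    case (Basic S)
    then obtain g r where "S = {x. \<langle>x, g\<rangle> \<in> {..r}}" by auto
    with same_transform_on_Int_halfspace[OF M N Basic.prems, of "{..r}" g] show ?case by simp
  next
    case Empty
    show ?case by (simp add: same_transform_on_def)
  next
    case (Compl S)
    have "E \<inter> (UNIV - S) = E - E \<inter> S" by blast
    with diff[OF Compl.prems Compl.IH[OF Compl.prems]] show ?case by simp
  next
    case (Union A)
    define F where "F n = E - (\<Union>i<n. A i)" for n
    have F: "?good (F n)" for n
    proof (induction n)
      case 0
      with Union.prems show ?case by (simp add: F_def)
    next
      case (Suc n)
      have "F (Suc n) = F n - F n \<inter> A n" by (auto simp: F_def less_Suc_eq)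
      with diff[OF Suc Union.IH[OF Suc]] show ?case by simp
    qed
    have "?good (\<Inter>n. F n)"
      by (rule same_transform_on_decreasing_INT[OF M N F])
        (fastforce simp: F_def decseq_def)
    moreover have "E \<inter> (\<Union>i. A i) = E - (\<Inter>n. F n)" by (auto simp: F_def)
    ultimately show ?case
      using diff[OF Union.prems, of "\<Inter>n. F n"] by (auto simp: F_def)
  qed
  have "?good UNIV" using eq by (simp add: same_transform_on_def)
  have good: "?good S" if "S \<in> sets borel" for S
  proof -
    have "S \<in> sigma_sets UNIV (range (\<lambda>(g, r). {x. \<langle>x, g\<rangle> \<le> r}))"
      using that by (subst (asm) borel_eq_sigma_halfspaces) (simp add: sets_measure_of)
    from inter[OF this \<open>?good UNIV\<close>] show ?thesis by simp
  qed
  interpret M: finite_measure M by fact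
  interpret N: finite_measure N by fact
  show ?thesis
  proof (rule measure_eqI)
    show "sets M = sets N" using M N by simp
    fix S assume S: "S \<in> sets M"
    have "(CLINT x|R. indicator S x *\<^sub>R iexp \<langle>x, 0\<rangle>) = of_real (measure R S)"
      if "finite_measure R" "sets R = sets borel" for R
    proof -
      have "(CLINT x|R. indicator S x *\<^sub>R iexp \<langle>x, 0\<rangle>) = (CLINT x|R. of_real (indicator S x))"
        by (simp add: scaleR_conv_of_real)
      also have "\<dots> = of_real (measure R S)"
        using S M that sets.sets_into_space[of S R]
        by (simp only: integral_complex_of_real) (auto simp: Int_absorb2)
      finally show ?thesis .
    qed
    from this[OF M] this[OF N] good[of S] S M(2) have "measure M S = measure N S"
      unfolding same_transform_on_def by (metis of_real_eq_iff)
    then show "emeasure M S = emeasure N S"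
      by (simp add: M.emeasure_eq_measure N.emeasure_eq_measure)
  qed
qed

section \<open>Gaussian measures and their affine images\<close>

lemma gaussian_real_translate:
  assumes "gaussian_real N"
  shows "gaussian_real (distr N borel (\<lambda>x. x + c))"
  using assms unfolding gaussian_real_def
proof (elim disjE exE conjE)
  fix m assume "N = return borel m"
  then have "distr N borel (\<lambda>x. x + c) = return borel (m + c)" by (simp add: distr_return)
  then show "(\<exists>m. distr N borel (\<lambda>x. x + c) = return borel m) \<or>
     (\<exists>m \<sigma>. \<sigma> > 0 \<and> distr N borel (\<lambda>x. x + c) = density lborel (\<lambda>x. ennreal (normal_density m \<sigma> x)))"
    by blast
next
  fix m \<sigma> :: real assume \<sigma>: "\<sigma> > 0" and N: "N = density lborel (\<lambda>x. ennreal (normal_density m \<sigma> x))"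
  interpret prob_space N unfolding N by (rule prob_space_normal_density[OF \<sigma>])
  have sets[measurable_cong]: "sets N = sets borel" by (simp add: N)
  have "distributed N lborel (\<lambda>x. x) (normal_density m \<sigma>)"
    unfolding distributed_def
    by (auto simp: sets N intro!: distr_id2 cong: measurable_cong_sets)
  from normal_density_affine[OF this \<sigma>, of 1 c]
  have "distr N lborel (\<lambda>x. c + x) = density lborel (normal_density (c + m) \<sigma>)"
    by (simp add: distributed_def)
  moreover have "distr N lborel (\<lambda>x. c + x) = distr N borel (\<lambda>x. x + c)"
    by (rule distr_cong) (auto simp: add.commute)
  ultimately show "(\<exists>m. distr N borel (\<lambda>x. x + c) = return borel m) \<or>
     (\<exists>m \<sigma>. \<sigma> > 0 \<and> distr N borel (\<lambda>x. x + c) = density lborel (\<lambda>x. ennreal (normal_density m \<sigma> x)))"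
    using \<sigma> by metis
qed

text \<open>
  Point masses fit the formula with variance 0.
\<close>

lemma char_gaussian_real:
  assumes "gaussian_real N"
  defines "m \<equiv> LINT x|N. x" and "v \<equiv> LINT x|N. (x - (LINT x|N. x))\<^sup>2"
  shows "char N t = iexp (t * m) * exp (- (v * t\<^sup>2) / 2)"
  using assms(1) unfolding gaussian_real_def
proof (elim disjE exE conjE)
  fix c assume N: "N = return borel c"
  then have "m = c" "v = 0" by (auto simp: m_def v_def integral_return)
  then show ?thesis by (simp add: N char_def integral_return)
next
  fix c \<sigma> :: real assume \<sigma>: "\<sigma> > 0" and N: "N = density lborel (\<lambda>x. ennreal (normal_density c \<sigma> x))"
  interpret prob_space N unfolding N by (rule prob_space_normal_density[OF \<sigma>])
  have sets[measurable_cong]: "sets N = sets borel" by (simp add: N)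
  have D: "distributed N lborel (\<lambda>x. x) (normal_density c \<sigma>)"
    unfolding distributed_def
    by (auto simp: sets N intro!: distr_id2 cong: measurable_cong_sets)
  have m: "m = c" using normal_distributed_expectation[OF \<sigma> D] by (simp add: m_def)
  have v: "v = \<sigma>\<^sup>2" using normal_distributed_variance[OF \<sigma> D] by (simp add: v_def)
  have S: "distr N lborel (\<lambda>x. (x - c) / \<sigma>) = std_normal_distribution"
    using D normal_standard_normal_convert[OF \<sigma>, of "\<lambda>x. x" c] by (simp add: distributed_def)
  have "char N t = (CLINT x|N. iexp (t * c) * iexp ((t * \<sigma>) * ((x - c) / \<sigma>)))"
    unfolding char_def using \<sigma>
    by (intro Bochner_Integration.integral_cong) (auto simp: exp_add[symmetric] field_simps)
  also have "\<dots> = iexp (t * c) * (CLINT x|N. iexp ((t * \<sigma>) * ((x - c) / \<sigma>)))"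
    by simp
  also have "(CLINT x|N. iexp ((t * \<sigma>) * ((x - c) / \<sigma>))) = char (distr N lborel (\<lambda>x. (x - c) / \<sigma>)) (t * \<sigma>)"
    unfolding char_def by (subst integral_distr) auto
  also have "\<dots> = exp (- (v * t\<^sup>2) / 2)"
    unfolding S char_std_normal_distribution by (simp add: v power_mult_distrib mult.commute)
  finally show ?thesis by (simp add: m)
qed

lemma gaussian_measureD:
  assumes "gaussian_measure M"
  shows "sets M = sets borel" "prob_space M" "gaussian_real (distr M borel (\<lambda>f. \<langle>f, g\<rangle>))"
  using assms by (auto simp: gaussian_measure_def)

lemma mean_elementD:
  assumes "mean_element M m"
  shows "integrable M (\<lambda>f. \<langle>f, g\<rangle>)" "(LINT f|M. \<langle>f, g\<rangle>) = \<langle>m, g\<rangle>"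
  using assms by (auto simp: mean_element_def)

lemma mean_element_unique: "mean_element M m \<Longrightarrow> mean_element M m' \<Longrightarrow> m = m'"
  by (rule dual_separates_points) (metis mean_elementD(2))

lemma covariance_operatorD:
  assumes "covariance_operator M C" "mean_element M m"
  shows "linear C"
    and "integrable M (\<lambda>f. (\<langle>f, g\<rangle> - \<langle>m, g\<rangle>) * (\<langle>f, h\<rangle> - \<langle>m, h\<rangle>))"
    and "\<langle>C g, h\<rangle> = (LINT f|M. (\<langle>f, g\<rangle> - \<langle>m, g\<rangle>) * (\<langle>f, h\<rangle> - \<langle>m, h\<rangle>))"
  using assms mean_element_unique[OF assms(2)] unfolding covariance_operator_def by blast+

lemma symmetric_positive_covariance:
  assumes "covariance_operator M C" "mean_element M m"
  shows "symmetric_positive C"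
  unfolding symmetric_positive_def
  by (auto simp: covariance_operatorD[OF assms] mult.commute intro!: integral_nonneg)

theorem gaussian_transform:
  assumes M: "gaussian_measure M" and m: "mean_element M m" and C: "covariance_operator M C"
  shows "(CLINT x|M. iexp \<langle>x, h\<rangle>) = iexp \<langle>m, h\<rangle> * exp (- \<langle>C h, h\<rangle> / 2)"
proof -
  have [measurable_cong]: "sets M = sets borel" by (rule gaussian_measureD[OF M])
  let ?N = "distr M borel (\<lambda>f. \<langle>f, h\<rangle>)"
  have mean: "(LINT x|?N. x) = \<langle>m, h\<rangle>"
    by (subst integral_distr) (auto simp: mean_elementD[OF m])
  have var: "(LINT x|?N. (x - (LINT x|?N. x))\<^sup>2) = \<langle>C h, h\<rangle>"
    unfolding mean
    by (subst integral_distr) (auto simp: covariance_operatorD(3)[OF C m] power2_eq_square)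
  have "(CLINT x|M. iexp \<langle>x, h\<rangle>) = char ?N 1"
    unfolding char_def by (subst integral_distr) auto
  also have "\<dots> = iexp (1 * (LINT x|?N. x)) * exp (- ((LINT x|?N. (x - (LINT x|?N. x))\<^sup>2) * 1\<^sup>2) / 2)"
    by (rule char_gaussian_real[OF gaussian_measureD(3)[OF M]])
  finally show ?thesis unfolding var unfolding mean by simp
qed

lemma gaussian_measure_affine_image:
  fixes T :: "'a::{banach, second_countable_topology} \<Rightarrow>\<^sub>L 'c::{banach, second_countable_topology}"
  assumes M: "gaussian_measure M"
  shows "gaussian_measure (distr M borel (\<lambda>x. T x + c))"
  unfolding gaussian_measure_def
proof (intro conjI allI)
  have [measurable_cong]: "sets M = sets borel" by (rule gaussian_measureD[OF M])
  show "prob_space (distr M borel (\<lambda>x. T x + c))"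
    by (rule prob_space.prob_space_distr[OF gaussian_measureD(2)[OF M]]) measurable
  fix g
  have "distr (distr M borel (\<lambda>x. T x + c)) borel (\<lambda>f. \<langle>f, g\<rangle>) =
      distr (distr M borel (\<lambda>f. \<langle>f, g o\<^sub>L T\<rangle>)) borel (\<lambda>x. x + \<langle>c, g\<rangle>)"
    by (simp add: distr_distr comp_def blinfun.add_right)
  then show "gaussian_real (distr (distr M borel (\<lambda>x. T x + c)) borel (\<lambda>f. \<langle>f, g\<rangle>))"
    by (simp only: gaussian_real_translate[OF gaussian_measureD(3)[OF M]])
qed simp

lemma mean_element_affine_image:
  fixes T :: "'a::{banach, second_countable_topology} \<Rightarrow>\<^sub>L 'c::{banach, second_countable_topology}"
  assumes M: "gaussian_measure M" and m: "mean_element M m"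
  shows "mean_element (distr M borel (\<lambda>x. T x + c)) (T m + c)"
  unfolding mean_element_def
proof (intro allI conjI)
  have [measurable_cong]: "sets M = sets borel" by (rule gaussian_measureD[OF M])
  interpret prob_space M by (rule gaussian_measureD[OF M])
  fix g
  note mm = mean_elementD[OF m, of "g o\<^sub>L T"]
  show "integrable (distr M borel (\<lambda>x. T x + c)) (\<lambda>f. \<langle>f, g\<rangle>)"
    using mm(1) by (subst integrable_distr_eq) (auto simp: blinfun.add_right)
  show "(LINT f|distr M borel (\<lambda>x. T x + c). \<langle>f, g\<rangle>) = \<langle>T m + c, g\<rangle>"
    using mm by (subst integral_distr) (auto simp: blinfun.add_right prob_space)
qed

text \<open>
  The operator \<open>D\<close> stands for \<open>T C T\<^sup>*\<close>; it is characterised by its bilinear form so that the caller may supply a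
  formula of its own.
\<close>

lemma covariance_operator_affine_image:
  fixes T :: "'a::{banach, second_countable_topology} \<Rightarrow>\<^sub>L 'c::{banach, second_countable_topology}"
  assumes M: "gaussian_measure M" and m: "mean_element M m" and C: "covariance_operator M C"
    and D: "linear D" "\<And>g h. \<langle>D g, h\<rangle> = \<langle>C (g o\<^sub>L T), h o\<^sub>L T\<rangle>"
  shows "covariance_operator (distr M borel (\<lambda>x. T x + c)) D"
  unfolding covariance_operator_def
proof (intro conjI exI[of _ "T m + c"] allI)
  have [measurable_cong]: "sets M = sets borel" by (rule gaussian_measureD[OF M])
  show "linear D" by fact
  show "mean_element (distr M borel (\<lambda>x. T x + c)) (T m + c)"
    by (rule mean_element_affine_image[OF M m])
  fix g h
  note CC = covariance_operatorD(2,3)[OF C m, where g = "g o\<^sub>L T" and h = "h o\<^sub>L T"]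
  show "integrable (distr M borel (\<lambda>x. T x + c))
      (\<lambda>f. (\<langle>f, g\<rangle> - \<langle>T m + c, g\<rangle>) * (\<langle>f, h\<rangle> - \<langle>T m + c, h\<rangle>))"
    using CC(1) by (subst integrable_distr_eq) (auto simp: blinfun.add_right)
  show "\<langle>D g, h\<rangle> = (LINT f|distr M borel (\<lambda>x. T x + c).
      (\<langle>f, g\<rangle> - \<langle>T m + c, g\<rangle>) * (\<langle>f, h\<rangle> - \<langle>T m + c, h\<rangle>))"
    using CC(2) by (subst integral_distr) (auto simp: blinfun.add_right D(2))
qed

section \<open>Representing families\<close>

lemma symmetric_positiveD:
  assumes "symmetric_positive R"
  shows "linear R" "\<langle>R f, g\<rangle> = \<langle>R g, f\<rangle>" "\<langle>R f, f\<rangle> \<ge> 0"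
  using assms unfolding symmetric_positive_def by blast+

text \<open>
  The discriminant argument for the Cauchy-Schwarz inequality: if \<open>\<langle>R g, h\<rangle> \<noteq> 0\<close>, the form is affine and not
  constant along \<open>h + t *\<^sub>R g\<close>, hence negative somewhere.
\<close>

lemma symmetric_positive_null:
  assumes R: "symmetric_positive R" and g: "\<langle>R g, g\<rangle> = 0"
  shows "R g = 0"
proof (rule dual_separates_points)
  interpret linear R by (rule symmetric_positiveD[OF R])
  fix h
  define a where "a = \<langle>R g, h\<rangle>"
  have "a = 0"
  proof (rule ccontr)
    assume "a \<noteq> 0"
    \<comment> \<open>chosen so that the form takes the value \<open>-1\<close> at \<open>h + t *\<^sub>R g\<close>\<close>
    define t where "t = - (\<langle>R h, h\<rangle> + 1) / (2 * a)"
    have "0 \<le> \<langle>R (h + t *\<^sub>R g), h + t *\<^sub>R g\<rangle>" by (rule symmetric_positiveD[OF R])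
    also have "\<dots> = \<langle>R h, h\<rangle> + 2 * t * a"
      using g symmetric_positiveD(2)[OF R, of h g]
      by (simp add: add scaleR blinfun.add_left blinfun.add_right blinfun.scaleR_left
          blinfun.scaleR_right a_def)
    also have "\<dots> = - 1" using \<open>a \<noteq> 0\<close> by (simp add: t_def field_simps)
    finally show False by simp
  qed
  then show "\<langle>R g, h\<rangle> = \<langle>0, h\<rangle>" by (simp add: a_def)
qed

definition orthonormal_family ::
  "(('a::real_normed_vector \<Rightarrow>\<^sub>L real) \<Rightarrow> 'a) \<Rightarrow> 'i set \<Rightarrow> ('i \<Rightarrow> 'a \<Rightarrow>\<^sub>L real) \<Rightarrow> bool" where
  "orthonormal_family R I x \<longleftrightarrow> (\<forall>i\<in>I. \<forall>j\<in>I. \<langle>R (x i), x j\<rangle> = (if i = j then 1 else 0))"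

text \<open>
  What remains of \<open>g\<close> after its \<open>R\<close>-orthogonal projection onto the span of an orthonormal family.
\<close>

definition residual ::
  "(('a::real_normed_vector \<Rightarrow>\<^sub>L real) \<Rightarrow> 'a) \<Rightarrow> 'i set \<Rightarrow> ('i \<Rightarrow> 'a \<Rightarrow>\<^sub>L real) \<Rightarrow>
    ('a \<Rightarrow>\<^sub>L real) \<Rightarrow> ('a \<Rightarrow>\<^sub>L real)" where
  "residual R I x g = g - (\<Sum>i\<in>I. \<langle>R (x i), g\<rangle> *\<^sub>R x i)"

lemma residual_orthogonal:
  assumes R: "symmetric_positive R" and I: "finite I" "orthonormal_family R I x" and j: "j \<in> I"
  shows "\<langle>R (residual R I x g), x j\<rangle> = 0" "\<langle>R (x j), residual R I x g\<rangle> = 0"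
proof -
  show "\<langle>R (x j), residual R I x g\<rangle> = 0"
  proof -
    have "(\<Sum>i\<in>I. \<langle>R (x i), g\<rangle> * \<langle>R (x j), x i\<rangle>) = (\<Sum>i\<in>I. if i = j then \<langle>R (x i), g\<rangle> else 0)"
      using I j by (intro sum.cong) (auto simp: orthonormal_family_def)
    also have "\<dots> = \<langle>R (x j), g\<rangle>" using I j by simp
    finally show ?thesis
      by (simp add: residual_def blinfun.diff_left blinfun.sum_left blinfun.scaleR_left)
  qed
  with symmetric_positiveD(2)[OF R] show "\<langle>R (residual R I x g), x j\<rangle> = 0" by metis
qed

text \<open>
  Bessel's inequality with its defect made explicit.
\<close>

lemma residual_square:
  assumes R: "symmetric_positive R" and I: "finite I" "orthonormal_family R I x"
  shows "\<langle>R (residual R I x g), residual R I x g\<rangle> = \<langle>R g, g\<rangle> - (\<Sum>i\<in>I. \<langle>R (x i), g\<rangle>\<^sup>2)"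
proof -
  interpret linear R by (rule symmetric_positiveD[OF R])
  let ?r = "residual R I x g"
  have *: "\<langle>v, ?r\<rangle> = \<langle>v, g\<rangle> - (\<Sum>i\<in>I. \<langle>R (x i), g\<rangle> * \<langle>v, x i\<rangle>)" for v
    by (simp add: residual_def blinfun.diff_left blinfun.sum_left blinfun.scaleR_left)
  have "\<langle>R ?r, ?r\<rangle> = \<langle>R ?r, g\<rangle> - (\<Sum>i\<in>I. \<langle>R (x i), g\<rangle> * \<langle>R ?r, x i\<rangle>)"
    using * .
  also have "\<dots> = \<langle>R ?r, g\<rangle>" using residual_orthogonal(1)[OF R I] by simp
  also have "\<dots> = \<langle>R g, g\<rangle> - (\<Sum>i\<in>I. \<langle>R (x i), g\<rangle>\<^sup>2)"
    by (simp add: residual_def diff sum scaleR blinfun.diff_right blinfun.sum_right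
        blinfun.scaleR_right power2_eq_square)
  finally show ?thesis .
qed

text \<open>
  For a finite family, the summation condition in \<open>representing\<close> says that every residual is \<open>R\<close>-null.
\<close>

lemma representing_finite_iff:
  assumes "symmetric_positive R" "finite I"
  shows "representing R I x \<longleftrightarrow>
    orthonormal_family R I x \<and> (\<forall>g. \<langle>R (residual R I x g), residual R I x g\<rangle> = 0)"
proof -
  have "((\<lambda>i. \<langle>R (x i), g\<rangle>\<^sup>2) has_sum \<langle>R g, g\<rangle>) I \<longleftrightarrow> (\<Sum>i\<in>I. \<langle>R (x i), g\<rangle>\<^sup>2) = \<langle>R g, g\<rangle>" for g
    using \<open>finite I\<close> by (auto simp: has_sum_finite_iff) 
  with residual_square[OF assms] show ?thesis
    unfolding representing_def orthonormal_family_def[symmetric] by auto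
qed

lemma representing_expansion:
  assumes R: "symmetric_positive R" and I: "finite I" "representing R I x"
  shows "R g = (\<Sum>i\<in>I. \<langle>R (x i), g\<rangle> *\<^sub>R R (x i))"
proof -
  interpret linear R by (rule symmetric_positiveD[OF R])
  have "R (residual R I x g) = 0"
    using I representing_finite_iff[OF R I(1)] by (intro symmetric_positive_null[OF R]) auto
  then show ?thesis by (simp add: residual_def diff sum scaleR)
qed

lemma orthonormal_family_independent:
  assumes I: "finite I" and x: "orthonormal_family R I x"
  shows "inj_on (\<lambda>i. R (x i)) I" "independent ((\<lambda>i. R (x i)) ` I)"
proof -
  show inj: "inj_on (\<lambda>i. R (x i)) I"
    using x unfolding orthonormal_family_def inj_on_def by (metis zero_neq_one)
  show "independent ((\<lambda>i. R (x i)) ` I)"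
  proof (rule independent_if_scalars_zero)
    show "finite ((\<lambda>i. R (x i)) ` I)" using I by simp
    fix u v assume 0: "(\<Sum>v\<in>(\<lambda>i. R (x i)) ` I. u v *\<^sub>R v) = 0" and "v \<in> (\<lambda>i. R (x i)) ` I"
    then obtain j where j: "j \<in> I" "v = R (x j)" by blast
    have "0 = \<langle>\<Sum>i\<in>I. u (R (x i)) *\<^sub>R R (x i), x j\<rangle>"
      using 0 by (simp add: sum.reindex[OF inj])
    also have "\<dots> = (\<Sum>i\<in>I. if i = j then u (R (x i)) else 0)"
      unfolding blinfun.sum_right blinfun.scaleR_right
      using x j by (intro sum.cong) (auto simp: orthonormal_family_def)
    also have "\<dots> = u v" using I j by simp
    finally show "u v = 0" by simp
  qed
qed

text \<open>
  Gram-Schmidt: an \<open>R\<close>-orthonormal family has linearly independent images under \<open>R\<close>, so its length is bounded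
  by the rank. If the residual of some functional were not \<open>R\<close>-null, it could be normalised and appended to a
  family of maximal length. The images then span the range, so the length is exactly the rank.
\<close>

theorem representing_family_exists:
  assumes R: "symmetric_positive R" and rank: "has_finite_rank R p"
  obtains x where "representing R {1..p} x"
proof -
  interpret linear R by (rule symmetric_positiveD[OF R])
  obtain B where B: "finite B" "range R \<subseteq> span B" and p: "dim (range R) = p"
    using rank unfolding has_finite_rank_def by blast
  let ?P = "\<lambda>n :: nat. \<exists>x. orthonormal_family R {1..n} x"
  have "?P 0" by (simp add: orthonormal_family_def)
  moreover have bound: "n \<le> card B" if P: "?P n" for n
  proof -
    obtain x where x: "orthonormal_family R {1..n} x" using P by blast
    note ind = orthonormal_family_independent[OF finite_atLeastAtMost x]
    have "card ((\<lambda>i. R (x i)) ` {1..n}) \<le> card B"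
      using B ind(2) by (intro conjunct2[OF independent_span_bound]) auto
    then show ?thesis using card_image[OF ind(1)] by simp
  qed
  ultimately obtain n where n: "?P n" "\<And>k. ?P k \<Longrightarrow> k \<le> n"
    using Nat.ex_has_greatest_nat[of ?P 0 "card B"] by blast
  obtain x where x: "orthonormal_family R {1..n} x" using n(1) by blast
  have "\<langle>R (residual R {1..n} x g), residual R {1..n} x g\<rangle> = 0" for g
  proof (rule ccontr)
    define r where "r = residual R {1..n} x g"
    assume "\<langle>R (residual R {1..n} x g), residual R {1..n} x g\<rangle> \<noteq> 0"
    then have pos: "\<langle>R r, r\<rangle> > 0" using symmetric_positiveD(3)[OF R, of r] by (simp add: r_def)
    define s where "s = 1 / sqrt \<langle>R r, r\<rangle>"
    have s: "s * (s * \<langle>R r, r\<rangle>) = 1"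
      using pos by (simp add: s_def field_simps flip: power2_eq_square)
    have orth: "\<langle>R r, x j\<rangle> = 0" "\<langle>R (x j), r\<rangle> = 0" if "j \<in> {1..n}" for j
      using residual_orthogonal[OF R _ x that] by (auto simp: r_def)
    have "orthonormal_family R {1..Suc n} (x(Suc n := s *\<^sub>R r))"
      using x orth s unfolding orthonormal_family_def
      by (auto simp: scaleR blinfun.scaleR_left blinfun.scaleR_right le_Suc_eq)
    with n(2)[of "Suc n"] show False by auto
  qed
  with x have rep: "representing R {1..n} x"
    by (simp add: representing_finite_iff[OF R])
  have "n = p"
  proof -
    note ind = orthonormal_family_independent[OF finite_atLeastAtMost x]
    have "range R \<subseteq> span ((\<lambda>i. R (x i)) ` {1..n})"
    proof
      fix v assume "v \<in> range R"
      then obtain g where v: "v = R g" by blast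
      show "v \<in> span ((\<lambda>i. R (x i)) ` {1..n})"
        unfolding v by (subst representing_expansion[OF R finite_atLeastAtMost rep])
          (rule span_sum, rule span_scale, rule span_base, rule imageI)
    qed
    then have "dim (range R) = card ((\<lambda>i. R (x i)) ` {1..n})"
      using ind(2) by (intro dim_unique[of "(\<lambda>i. R (x i)) ` {1..n}"]) auto
    with p show ?thesis using card_image[OF ind(1)] by simp
  qed
  with rep that show thesis by blast
qed

section \<open>Conditioning on a linear observation\<close>

text \<open>
  Uncorrelated linear images of a Gaussian vector are independent. This is expressed without conditional
  probabilities: if \<open>T\<close> and \<open>U\<close> add up to the identity and are uncorrelated, then \<open>T x + U y\<close> for
  independent copies \<open>x\<close>, \<open>y\<close> has the law of \<open>T x + U x = x\<close>. The characteristic functional of the sum factorises by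
  Fubini, and the quadratic forms in the exponents add up because the mixed term vanishes.
\<close>

theorem gaussian_independent_sum:
  fixes M :: "'a::{banach, second_countable_topology} measure" and T U :: "'a \<Rightarrow>\<^sub>L 'a"
  assumes M: "gaussian_measure M" and m: "mean_element M m" and C: "covariance_operator M C"
    and TU: "\<And>x. T x + U x = x"
    and uncorrelated: "\<And>h. \<langle>C (h o\<^sub>L T), h o\<^sub>L U\<rangle> = 0"
  shows "distr (M \<Otimes>\<^sub>M M) borel (\<lambda>(x, y). T x + U y) = M"
proof (rule finite_measure_eq_if_transform_eq)
  have sets[measurable_cong]: "sets M = sets borel" by (rule gaussian_measureD[OF M])
  interpret M: prob_space M by (rule gaussian_measureD[OF M])
  interpret MM: pair_prob_space M M ..
  interpret C: linear C by (rule covariance_operatorD[OF C m])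
  have sym: "\<langle>C f, g\<rangle> = \<langle>C g, f\<rangle>" for f g
    using symmetric_positiveD(2)[OF symmetric_positive_covariance[OF C m]] .
  show "finite_measure (distr (M \<Otimes>\<^sub>M M) borel (\<lambda>(x, y). T x + U y))"
    by (intro MM.finite_measure_distr) measurable
  show "finite_measure M" by (rule M.finite_measure_axioms)
  show "sets M = sets borel" by (rule sets)
  fix h :: "'a \<Rightarrow>\<^sub>L real"
  define a b where "a = h o\<^sub>L T" and "b = h o\<^sub>L U"
  have h: "h = a + b"
    by (rule blinfun_eqI) (simp add: a_def b_def blinfun.add_left TU flip: blinfun.add_right)
  have split: "iexp \<langle>T x + U y, h\<rangle> = iexp \<langle>x, a\<rangle> * iexp \<langle>y, b\<rangle>" for x y
    by (simp add: a_def b_def blinfun.add_right distrib_left exp_add)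
  have "(CLINT z|distr (M \<Otimes>\<^sub>M M) borel (\<lambda>(x, y). T x + U y). iexp \<langle>z, h\<rangle>) =
      (CLINT z|M \<Otimes>\<^sub>M M. (case z of (x, y) \<Rightarrow> iexp \<langle>x, a\<rangle> * iexp \<langle>y, b\<rangle>))"
    by (subst integral_distr) (auto simp only: split case_prod_beta' measurable_split_conv, measurable)
  also have "\<dots> = (CLINT x|M. (CLINT y|M. iexp \<langle>x, a\<rangle> * iexp \<langle>y, b\<rangle>))"
  proof (subst MM.integral_fst'[symmetric])
    show "integrable (M \<Otimes>\<^sub>M M) (\<lambda>z. case z of (x, y) \<Rightarrow> iexp \<langle>x, a\<rangle> * iexp \<langle>y, b\<rangle>)"
      by (rule MM.integrable_const_bound[where B = 1])
        (auto simp: norm_mult norm_exp_i_times case_prod_beta')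
  qed simp
  also have "\<dots> = (CLINT x|M. iexp \<langle>x, a\<rangle>) * (CLINT y|M. iexp \<langle>y, b\<rangle>)"
    by simp
  also have "\<dots> = iexp \<langle>m, a\<rangle> * exp (- \<langle>C a, a\<rangle> / 2) * (iexp \<langle>m, b\<rangle> * exp (- \<langle>C b, b\<rangle> / 2))"
    by (simp only: gaussian_transform[OF M m C])
  also have "\<dots> = iexp \<langle>m, h\<rangle> * exp (- \<langle>C h, h\<rangle> / 2)"
  proof -
    have "\<langle>C h, h\<rangle> = \<langle>C a, a\<rangle> + \<langle>C b, b\<rangle>"
    proof -
      have "\<langle>C a, b\<rangle> = 0" using uncorrelated[of h] by (simp only: a_def b_def)
      with sym[of b a] show ?thesis
        by (simp add: h C.add blinfun.add_left blinfun.add_right)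
    qed
    moreover have "\<langle>m, h\<rangle> = \<langle>m, a\<rangle> + \<langle>m, b\<rangle>" by (simp add: h blinfun.add_left)
    moreover have "iexp u * of_real (exp (- s / 2)) * (iexp v * of_real (exp (- t / 2))) =
        iexp (u + v) * of_real (exp (- (s + t) / 2))" for u v s t :: real
      by (simp add: exp_add[symmetric] add_divide_distrib diff_divide_distrib algebra_simps
          flip: exp_of_real)
    ultimately show ?thesis by (simp only:)
  qed
  also have "\<dots> = (CLINT x|M. iexp \<langle>x, h\<rangle>)"
    by (simp only: gaussian_transform[OF M m C])
  finally show "(CLINT z|distr (M \<Otimes>\<^sub>M M) borel (\<lambda>(x, y). T x + U y). iexp \<langle>z, h\<rangle>) =
      (CLINT x|M. iexp \<langle>x, h\<rangle>)" .
qed simp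

text \<open>
  Each functional of \<open>T x\<close> is almost surely equal to its mean; countably many functionals determine \<open>T x\<close>, so
  the exceptional null sets can be united.
\<close>

lemma AE_eq_mean_if_variance_zero:
  fixes T :: "'a::{banach, second_countable_topology} \<Rightarrow>\<^sub>L 'b::{banach, second_countable_topology}"
  assumes m: "mean_element M m" and C: "covariance_operator M C"
    and var: "\<And>g. \<langle>C (g o\<^sub>L T), g o\<^sub>L T\<rangle> = 0"
  shows "AE x in M. T x = T m"
proof -
  obtain g :: "nat \<Rightarrow> 'b \<Rightarrow>\<^sub>L real" where g: "\<And>x r. norm x \<le> r \<longleftrightarrow> (\<forall>n. \<langle>x, g n\<rangle> \<le> r)"
    using countable_norming_set by blast
  have "AE x in M. \<langle>T x, g n\<rangle> = \<langle>T m, g n\<rangle>" for n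
  proof -
    let ?d = "\<lambda>x. \<langle>x, g n o\<^sub>L T\<rangle> - \<langle>m, g n o\<^sub>L T\<rangle>"
    have "integrable M (\<lambda>x. ?d x * ?d x)" "(LINT x|M. ?d x * ?d x) = 0"
      using covariance_operatorD(2,3)[OF C m, where g = "g n o\<^sub>L T" and h = "g n o\<^sub>L T"] var[of "g n"]
      by auto
    then have "AE x in M. ?d x * ?d x = 0"
      by (subst (asm) integral_nonneg_eq_0_iff_AE) auto
    then show ?thesis by (rule AE_mp) simp
  qed
  then have "AE x in M. \<forall>n. \<langle>T x, g n\<rangle> = \<langle>T m, g n\<rangle>" by (subst AE_all_countable) blast
  then show ?thesis
  proof (rule AE_mp, intro AE_I2 impI)
    fix x assume "\<forall>n. \<langle>T x, g n\<rangle> = \<langle>T m, g n\<rangle>"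
    then have "norm (T x - T m) \<le> 0" by (simp add: g blinfun.diff_right)
    then show "T x = T m" by simp
  qed
qed

text \<open>
  The linear part of the conditional mean (the gain operator of Kalman filtering): it maps a deviation of the
  observation from its mean to the predicted deviation of the state.
\<close>

definition gain ::
  "('a::real_normed_vector \<Rightarrow>\<^sub>L 'b::real_normed_vector) \<Rightarrow> (('a \<Rightarrow>\<^sub>L real) \<Rightarrow> 'a) \<Rightarrow>
   nat \<Rightarrow> (nat \<Rightarrow> 'b \<Rightarrow>\<^sub>L real) \<Rightarrow> ('b \<Rightarrow>\<^sub>L 'a)" where
  "gain G C p ys = (\<Sum>i=1..p. blinfun_scaleR_left (C (banach_adjoint G (ys i))) o\<^sub>L ys i)"

lemma gain_apply: "gain G C p ys z = (\<Sum>i=1..p. \<langle>z, ys i\<rangle> *\<^sub>R C (banach_adjoint G (ys i)))"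
  by (simp add: gain_def blinfun.sum_left)

lemma conditional_mean_gain: "conditional_mean G m C p ys y = m + gain G C p ys (y - G m)"
  by (simp add: conditional_mean_def gain_apply)

lemma adjoint_apply: "\<langle>x, banach_adjoint G g\<rangle> = \<langle>G x, g\<rangle>"
  by (simp add: banach_adjoint_def)

lemma linear_banach_adjoint: "linear (banach_adjoint G)"
  by (rule linearI; rule blinfun_eqI) (simp_all add: adjoint_apply blinfun.add_left blinfun.scaleR_left)

lemma symmetric_positive_image:
  assumes C: "symmetric_positive C"
  shows "symmetric_positive (\<lambda>g. G (C (banach_adjoint G g)))"
  unfolding symmetric_positive_def
proof (intro conjI allI)
  interpret C: linear C by (rule symmetric_positiveD[OF C])
  interpret A: linear "banach_adjoint G" by (rule linear_banach_adjoint)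
  show "linear (\<lambda>g. G (C (banach_adjoint G g)))"
    by (rule linearI) (simp_all add: A.add A.scaleR C.add C.scaleR blinfun.add_right blinfun.scaleR_right)
  show "\<langle>G (C (banach_adjoint G f)), g\<rangle> = \<langle>G (C (banach_adjoint G g)), f\<rangle>" for f g
    using symmetric_positiveD(2)[OF C] by (metis adjoint_apply)
  show "\<langle>G (C (banach_adjoint G f)), f\<rangle> \<ge> 0" for f
    using symmetric_positiveD(3)[OF C] by (metis adjoint_apply)
qed

text \<open>
  The residual \<open>r\<close> of \<open>g\<close> satisfies \<open>\<langle>C (G\<^sup>* r), G\<^sup>* r\<rangle> = 0\<close>, hence \<open>C (G\<^sup>* r) = 0\<close>. So on the range of
  \<open>G C G\<^sup>*\<close> the gain is determined by \<open>C\<close> and \<open>G\<close> alone; two representing families can only give different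
  gains off this range.
\<close>

lemma gain_image_covariance:
  assumes C: "symmetric_positive C"
    and ys: "representing (\<lambda>g. G (C (banach_adjoint G g))) {1..p} ys"
  shows "gain G C p ys (G (C (banach_adjoint G g))) = C (banach_adjoint G g)"
proof -
  let ?R = "\<lambda>g. G (C (banach_adjoint G g))"
  note R = symmetric_positive_image[OF C, of G]
  interpret C: linear C by (rule symmetric_positiveD[OF C])
  interpret A: linear "banach_adjoint G" by (rule linear_banach_adjoint)
  let ?r = "residual ?R {1..p} ys g"
  have "\<langle>?R ?r, ?r\<rangle> = 0" using ys representing_finite_iff[OF R, of "{1..p}"] by simp
  then have "C (banach_adjoint G ?r) = 0"
    by (intro symmetric_positive_null[OF C]) (simp add: adjoint_apply)
  then show ?thesis
    using symmetric_positiveD(2)[OF R, of g]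
    by (simp add: gain_apply residual_def A.diff A.sum A.scaleR C.diff C.sum C.scaleR)
qed

text \<open>
  Expand \<open>C (G\<^sup>* (ys i))\<close> in the second family and exchange the sums: by symmetry of \<open>G C G\<^sup>*\<close> the inner sum is
  the expansion of \<open>C (G\<^sup>* (zs j))\<close> in the first family.
\<close>

lemma conditional_covariance_unique:
  assumes C: "symmetric_positive C"
    and ys: "representing (\<lambda>g. G (C (banach_adjoint G g))) {1..p} ys"
    and zs: "representing (\<lambda>g. G (C (banach_adjoint G g))) {1..q} zs"
  shows "conditional_covariance G C p ys = conditional_covariance G C q zs"
proof
  fix f
  let ?R = "\<lambda>g. G (C (banach_adjoint G g))"
  let ?y = "\<lambda>i. C (banach_adjoint G (ys i))" and ?z = "\<lambda>j. C (banach_adjoint G (zs j))"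
  have sym: "\<langle>?R g, h\<rangle> = \<langle>?R h, g\<rangle>" for g h
    by (rule symmetric_positiveD(2)[OF symmetric_positive_image[OF C]])
  have "(\<Sum>i=1..p. \<langle>?y i, f\<rangle> *\<^sub>R ?y i) = (\<Sum>i=1..p. \<langle>?y i, f\<rangle> *\<^sub>R (\<Sum>j=1..q. \<langle>?R (ys i), zs j\<rangle> *\<^sub>R ?z j))"
    by (subst gain_image_covariance[OF C zs, symmetric]) (simp add: gain_apply)
  also have "\<dots> = (\<Sum>j=1..q. (\<Sum>i=1..p. \<langle>?y i, f\<rangle> * \<langle>?R (ys i), zs j\<rangle>) *\<^sub>R ?z j)"
    by (simp add: scaleR_sum_right scaleR_sum_left) (rule sum.swap)
  also have "\<dots> = (\<Sum>j=1..q. \<langle>gain G C p ys (?R (zs j)), f\<rangle> *\<^sub>R ?z j)"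
    by (simp add: gain_apply blinfun.sum_left blinfun.sum_right blinfun.scaleR_right sym[of "zs _"] mult.commute)
  also have "\<dots> = (\<Sum>j=1..q. \<langle>?z j, f\<rangle> *\<^sub>R ?z j)"
    by (simp add: gain_image_covariance[OF C ys])
  finally show "conditional_covariance G C p ys f = conditional_covariance G C q zs f"
    by (simp add: conditional_covariance_def)
qed

text \<open>
  The prediction error, i.e. the part of the state that the observation does not determine. It is uncorrelated
  with the observation, and its covariance is the conditional one.
\<close>

definition unobserved ::
  "('a::real_normed_vector \<Rightarrow>\<^sub>L 'b::real_normed_vector) \<Rightarrow> (('a \<Rightarrow>\<^sub>L real) \<Rightarrow> 'a) \<Rightarrow>
   nat \<Rightarrow> (nat \<Rightarrow> 'b \<Rightarrow>\<^sub>L real) \<Rightarrow> ('a \<Rightarrow>\<^sub>L 'a)" where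
  "unobserved G C p ys = id_blinfun - (gain G C p ys o\<^sub>L G)"

lemma unobserved_apply: "unobserved G C p ys x = x - gain G C p ys (G x)"
  by (simp add: unobserved_def blinfun.diff_left)

text \<open>
  In terms of \<open>U = unobserved G C p ys\<close>, the conditional covariance \<open>D\<close> is \<open>C U\<^sup>*\<close>; it vanishes on the range of
  \<open>G\<^sup>*\<close>, and therefore also equals \<open>U C U\<^sup>*\<close>. The identity \<open>D G\<^sup>* = 0\<close> carries the rest: it says both that
  \<open>U x\<close> is uncorrelated with \<open>G x\<close> and that \<open>G (U x)\<close> has no variance.
\<close>

lemma covariance_unobserved:
  assumes C: "symmetric_positive C"
    and ys: "representing (\<lambda>g. G (C (banach_adjoint G g))) {1..p} ys"
  shows "C (f o\<^sub>L unobserved G C p ys) = conditional_covariance G C p ys f"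
    and "conditional_covariance G C p ys (banach_adjoint G g) = 0"
    and "\<langle>conditional_covariance G C p ys f, h o\<^sub>L unobserved G C p ys\<rangle> =
      \<langle>conditional_covariance G C p ys f, h\<rangle>"
    and "linear (conditional_covariance G C p ys)"
proof -
  let ?R = "\<lambda>g. G (C (banach_adjoint G g))"
  let ?D = "conditional_covariance G C p ys" and ?U = "unobserved G C p ys"
  let ?e = "\<lambda>i. C (banach_adjoint G (ys i))"
  interpret C: linear C by (rule symmetric_positiveD[OF C])
  interpret A: linear "banach_adjoint G" by (rule linear_banach_adjoint)
  have U: "f o\<^sub>L ?U = f - (\<Sum>i=1..p. \<langle>?e i, f\<rangle> *\<^sub>R banach_adjoint G (ys i))" for f
    by (rule blinfun_eqI)
      (simp add: unobserved_apply gain_apply blinfun.diff_right blinfun.diff_left blinfun.sum_left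
        blinfun.sum_right blinfun.scaleR_left blinfun.scaleR_right adjoint_apply mult.commute)
  show CU: "C (f o\<^sub>L ?U) = ?D f" for f
    by (simp add: U C.diff C.sum C.scaleR conditional_covariance_def)
  have "\<langle>?e i, banach_adjoint G g\<rangle> = \<langle>?R g, ys i\<rangle>" for i g
    by (metis adjoint_apply symmetric_positiveD(2)[OF C])
  then show null: "?D (banach_adjoint G g) = 0" for g
    using gain_image_covariance[OF C ys, of g]
    by (simp add: conditional_covariance_def gain_apply)
  show "linear ?D"
  proof (rule linearI)
    have "(f + g) o\<^sub>L ?U = (f o\<^sub>L ?U) + (g o\<^sub>L ?U)" for f g :: "'a \<Rightarrow>\<^sub>L real"
      by (rule blinfun_eqI) (simp add: blinfun.add_left)
    then show "?D (f + g) = ?D f + ?D g" for f g by (simp only: CU[symmetric] C.add)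
    have "(c *\<^sub>R f) o\<^sub>L ?U = c *\<^sub>R (f o\<^sub>L ?U)" for c and f :: "'a \<Rightarrow>\<^sub>L real"
      by (rule blinfun_eqI) (simp add: blinfun.scaleR_left)
    then show "?D (c *\<^sub>R f) = c *\<^sub>R ?D f" for c f by (simp only: CU[symmetric] C.scaleR)
  qed
  have symD: "\<langle>?D f, h\<rangle> = \<langle>?D h, f\<rangle>" for f h
    using symmetric_positiveD(2)[OF C, of f h]
    by (simp add: conditional_covariance_def blinfun.diff_left blinfun.diff_right
        blinfun.sum_left blinfun.sum_right blinfun.scaleR_left blinfun.scaleR_right mult.commute)
  have "\<langle>?D f, banach_adjoint G (ys i)\<rangle> = 0" for i
    by (subst symD) (simp add: null)
  then show "\<langle>?D f, h o\<^sub>L ?U\<rangle> = \<langle>?D f, h\<rangle>"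
    by (simp add: U blinfun.diff_left blinfun.sum_left blinfun.scaleR_left)
qed

text \<open>
  The conditional law at \<open>y\<close> is the law of \<open>U x + L y\<close>, the independent prediction error added to the
  prediction from \<open>y\<close>. It is concentrated on the fibre over \<open>y\<close> because \<open>G (U x)\<close> is almost surely constant, for all
  \<open>y\<close> in the closed affine set where \<open>G L\<close> acts as the identity on \<open>y - G m\<close>; the observations almost
  surely lie in this set for the same reason. Integrating the conditional laws over the law of \<open>G x\<close> gives
  the law of \<open>U z + L (G x)\<close> for independent \<open>x\<close> and \<open>z\<close>, which is the original measure by
  \<open>gaussian_independent_sum\<close>.
\<close>

theorem gaussian_disintegration_conditional:
  fixes M :: "'a::{banach, second_countable_topology} measure"
    and G :: "'a \<Rightarrow>\<^sub>L 'b::{banach, second_countable_topology}"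
  assumes M: "gaussian_measure M" and m: "mean_element M m" and C: "covariance_operator M C"
    and ys: "representing (\<lambda>g. G (C (banach_adjoint G g))) {1..p} ys"
  defines "U \<equiv> unobserved G C p ys" and "L \<equiv> gain G C p ys"
  shows "gaussian_disintegration M G (conditional_mean G m C p ys) (conditional_covariance G C p ys)
    (\<lambda>y. distr M borel (\<lambda>x. U x + L y))"
proof -
  have sets[measurable_cong]: "sets M = sets borel" by (rule gaussian_measureD[OF M])
  have space: "space M = UNIV" using sets_eq_imp_space_eq[OF sets] by simp
  interpret M: prob_space M by (rule gaussian_measureD[OF M])
  note sp = symmetric_positive_covariance[OF C m]
  note cov = covariance_unobserved[OF sp ys, folded U_def]
  let ?D = "conditional_covariance G C p ys" and ?K = "\<lambda>y. distr M borel (\<lambda>x. U x + L y)"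
  have gauss: "gaussian_measure (?K y)" for y by (rule gaussian_measure_affine_image[OF M])
  have "U m + L y = conditional_mean G m C p ys y" for y
    by (simp add: conditional_mean_gain U_def L_def unobserved_apply blinfun.diff_right)
  with mean_element_affine_image[OF M m, of U]
  have mean: "mean_element (?K y) (conditional_mean G m C p ys y)" for y by metis
  have covK: "covariance_operator (?K y) ?D" for y
    by (rule covariance_operator_affine_image[OF M m C cov(4)]) (simp only: cov(1,3))
  have U_zero: "AE x in M. G (U x) = G (U m)"
  proof -
    have "\<langle>C (g o\<^sub>L (G o\<^sub>L U)), g o\<^sub>L (G o\<^sub>L U)\<rangle> = 0" for g
    proof -
      have "g o\<^sub>L (G o\<^sub>L U) = banach_adjoint G g o\<^sub>L U"
        by (rule blinfun_eqI) (simp add: adjoint_apply)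
      then show ?thesis by (simp only: cov(1,2) blinfun.zero_right)
    qed
    from AE_eq_mean_if_variance_zero[OF m C this] show ?thesis by simp
  qed
  have law: "distr (M \<Otimes>\<^sub>M M) borel (\<lambda>(x, z). L (G x) + U z) = M"
  proof -
    have *: "\<langle>C (h o\<^sub>L (L o\<^sub>L G)), h o\<^sub>L U\<rangle> = 0" for h
    proof -
      have "h o\<^sub>L (L o\<^sub>L G) = banach_adjoint G (h o\<^sub>L L)"
        by (rule blinfun_eqI) (simp add: adjoint_apply)
      then have "\<langle>C (h o\<^sub>L (L o\<^sub>L G)), h o\<^sub>L U\<rangle> = \<langle>?D h, banach_adjoint G (h o\<^sub>L L)\<rangle>"
        using symmetric_positiveD(2)[OF sp] cov(1) by metis
      also have "\<dots> = \<langle>?D (banach_adjoint G (h o\<^sub>L L)), h\<rangle>"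
        using symmetric_positiveD(2)[OF symmetric_positive_covariance[OF covK mean]] .
      finally show ?thesis by (simp add: cov(2))
    qed
    have "(L o\<^sub>L G) x + U x = x" for x by (simp add: U_def L_def unobserved_apply)
    from gaussian_independent_sum[OF M m C this *] show ?thesis by simp
  qed
  have emK: "emeasure (?K y) A = emeasure M (Pair y -` {(y, x). L y + U x \<in> A})"
    if "A \<in> sets borel" for y A
    using that by (simp add: emeasure_distr space vimage_def add.commute)
  have Q[measurable]: "{(y, x). L y + U x \<in> A} \<in> sets (borel \<Otimes>\<^sub>M M)"
    if [measurable]: "A \<in> sets borel" for A
  proof -
    have "{z \<in> space (borel \<Otimes>\<^sub>M M). L (fst z) + U (snd z) \<in> A} \<in> sets (borel \<Otimes>\<^sub>M M)"
      by measurable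
    then show ?thesis by (simp add: space_pair_measure space case_prod_beta')
  qed
  have em_meas: "(\<lambda>y. emeasure (?K y) A) \<in> borel_measurable borel" if "A \<in> sets borel" for A
    unfolding emK[OF that] by (rule M.measurable_emeasure_Pair[OF Q[OF that]])
  have "disintegration M borel (blinfun_apply G) ?K"
    unfolding disintegration_def
  proof (intro conjI ballI)
    show "sets (?K y) = sets M" for y by (simp add: sets)
    show "prob_space (?K y)" for y by (rule gaussian_measureD(2)[OF gauss])
    show "(\<lambda>y. measure (?K y) A) \<in> borel_measurable borel" if "A \<in> sets M" for A
      using em_meas[of A] that unfolding measure_def by (simp add: sets)
    let ?S = "{y. G (L (y - G m)) = y - G m}"
    \<comment> \<open>both conditions say that \<open>G L\<close> reproduces \<open>G x - G m\<close>\<close>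
    have S_iff: "x \<in> blinfun_apply G -` ?S \<longleftrightarrow> G (U x) = G (U m)" for x
      by (auto simp: U_def L_def unobserved_apply blinfun.diff_right algebra_simps)
    show "\<exists>S\<in>sets borel. measure (distr M borel (blinfun_apply G)) S = 1 \<and>
        (\<forall>y\<in>S. {y} \<in> sets borel \<and> measure (?K y) (blinfun_apply G -` {y} \<inter> space M) = 1)"
    proof (intro bexI[of _ ?S] conjI ballI)
      show S[measurable]: "?S \<in> sets borel" by measurable
      show "measure (distr M borel (blinfun_apply G)) ?S = 1"
      proof -
        have "measure (distr M borel (blinfun_apply G)) ?S = measure M (blinfun_apply G -` ?S)"
          by (subst measure_distr) (use S in \<open>auto simp: space\<close>)
        also have "\<dots> = 1"
        proof (rule M.prob_eq_1[THEN iffD2])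
          show "blinfun_apply G -` ?S \<in> M.events"
            using measurable_sets[of "blinfun_apply G" M borel ?S] S by (simp add: space)
          show "AE x in M. x \<in> blinfun_apply G -` ?S" using U_zero by (simp only: S_iff)
        qed
        finally show ?thesis .
      qed
      fix y assume y: "y \<in> ?S"
      show "{y} \<in> sets borel" by simp
      have "AE x in M. G (U x + L y) = y"
        using U_zero
      proof (rule AE_mp, intro AE_I2 impI)
        fix x assume "G (U x) = G (U m)"
        then have "G (U x + L y) = G (U m) + G (L y)" by (simp add: blinfun.add_right)
        also have "\<dots> = G m + G (L (y - G m))"
          by (simp add: U_def L_def unobserved_apply blinfun.diff_right)
        finally show "G (U x + L y) = y" using y by simp
      qed
      moreover have "{x. G (U x + L y) = y} \<in> sets borel" by measurable
      ultimately have "measure M {x. G (U x + L y) = y} = 1"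
        by (subst M.prob_eq_1) (auto simp: sets)
      moreover have "measure (?K y) (blinfun_apply G -` {y} \<inter> space M) =
          measure M {x. G (U x + L y) = y}"
      proof -
        have "blinfun_apply G -` {y} \<in> sets borel"
          using measurable_sets[of "blinfun_apply G" borel borel "{y}"] by simp
        then show ?thesis by (simp add: measure_distr space vimage_def)
      qed
      ultimately show "measure (?K y) (blinfun_apply G -` {y} \<inter> space M) = 1" by simp
    qed
    fix A assume "A \<in> sets M"
    then have A[measurable]: "A \<in> sets borel" by (simp add: sets)
    have prob: "prob_space (?K y)" for y by (rule gaussian_measureD(2)[OF gauss])
    have "emeasure M A = emeasure (distr (M \<Otimes>\<^sub>M M) borel (\<lambda>(x, z). L (G x) + U z)) A"
      by (simp only: law)
    also have "\<dots> = emeasure (M \<Otimes>\<^sub>M M) ((\<lambda>(x, z). L (G x) + U z) -` A)"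
      by (subst emeasure_distr) (auto simp: space_pair_measure space)
    also have "\<dots> = (\<integral>\<^sup>+x. emeasure M (Pair x -` ((\<lambda>(x, z). L (G x) + U z) -` A)) \<partial>M)"
    proof (rule M.emeasure_pair_measure_alt)
      have "(\<lambda>(x, z). L (G x) + U z) -` A \<inter> space (M \<Otimes>\<^sub>M M) \<in> sets (M \<Otimes>\<^sub>M M)"
        by measurable
      then show "(\<lambda>(x, z). L (G x) + U z) -` A \<in> sets (M \<Otimes>\<^sub>M M)"
        by (simp add: space_pair_measure space)
    qed
    also have "\<dots> = (\<integral>\<^sup>+x. emeasure (?K (G x)) A \<partial>M)"
      by (simp add: emK[OF A] vimage_def)
    also have "\<dots> = (\<integral>\<^sup>+y. emeasure (?K y) A \<partial>distr M borel (blinfun_apply G))"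
      using em_meas[OF A] by (subst nn_integral_distr) auto
    also have "\<dots> = (\<integral>\<^sup>+y. ennreal (measure (?K y) A) \<partial>distr M borel (blinfun_apply G))"
      by (simp add: finite_measure.emeasure_eq_measure[OF prob_space.finite_measure[OF prob]])
    finally have "measure M A = enn2real (\<integral>\<^sup>+y. ennreal (measure (?K y) A) \<partial>distr M borel (blinfun_apply G))"
      by (simp add: measure_def)
    also have "\<dots> = (LINT y|distr M borel (blinfun_apply G). measure (?K y) A)"
      using em_meas[OF A] unfolding measure_def
      by (intro integral_eq_nn_integral[symmetric]) (auto intro!: measurable_compose[OF _ borel_measurable_enn2real])
    finally show "measure M A = (LINT y|distr M borel (blinfun_apply G). measure (?K y) A)" .
  qed
  moreover have "continuous_affine (conditional_mean G m C p ys)"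
    unfolding continuous_affine_def conditional_mean_gain
    by (auto intro!: continuous_intros linearI
        simp: blinfun.diff_right blinfun.add_right blinfun.scaleR_right blinfun.minus_right
          algebra_simps)
  moreover have "symmetric_positive ?D" by (rule symmetric_positive_covariance[OF covK mean])
  ultimately show ?thesis
    using gauss mean covK by (simp add: gaussian_disintegration_def)
qed

theorem theorem6:
  fixes \<mu> :: "'a::{banach, second_countable_topology} measure"
    and m\<^sub>\<mu> :: 'a
    and C\<^sub>\<mu> :: "('a \<Rightarrow>\<^sub>L real) \<Rightarrow> 'a"
    and G :: "'a \<Rightarrow>\<^sub>L 'b::{banach, second_countable_topology}"
    and C\<^sub>\<nu> :: "('b \<Rightarrow>\<^sub>L real) \<Rightarrow> 'b"
    and Y\<^sub>0 :: "'b set"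
    and p :: nat
  assumes "gaussian_measure \<mu>"
    and "mean_element \<mu> m\<^sub>\<mu>"
    and "covariance_operator \<mu> C\<^sub>\<mu>"
    and "C\<^sub>\<nu> = (\<lambda>g. G (C\<^sub>\<mu> (banach_adjoint G g)))"
    and "has_finite_rank C\<^sub>\<nu> p"
    and "Y\<^sub>0 = (\<lambda>z. G m\<^sub>\<mu> + z) ` range C\<^sub>\<nu>"
  shows "\<exists>(m :: 'b \<Rightarrow> 'a) (C :: ('a \<Rightarrow>\<^sub>L real) \<Rightarrow> 'a) (K :: 'b \<Rightarrow> 'a measure).
    gaussian_disintegration \<mu> G m C K \<and>
    (\<forall>y\<in>Y\<^sub>0. G (m y) = y) \<and>
    (\<forall>ys :: nat \<Rightarrow> 'b \<Rightarrow>\<^sub>L real. representing C\<^sub>\<nu> {1..p} ys \<longrightarrow>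
       C = conditional_covariance G C\<^sub>\<mu> p ys \<and>
       (\<forall>y\<in>Y\<^sub>0. m y = conditional_mean G m\<^sub>\<mu> C\<^sub>\<mu> p ys y) \<and>
       (\<exists>K'. gaussian_disintegration \<mu> G (conditional_mean G m\<^sub>\<mu> C\<^sub>\<mu> p ys) C K'))"
proof -
  note M = assms(1-3) and C\<nu> = assms(4)
  have C: "symmetric_positive C\<^sub>\<mu>" by (rule symmetric_positive_covariance[OF M(3,2)])
  have "symmetric_positive C\<^sub>\<nu>" unfolding C\<nu> by (rule symmetric_positive_image[OF C])
  then obtain xs where xs: "representing C\<^sub>\<nu> {1..p} xs"
    using assms(5) by (rule representing_family_exists)
  note disint = gaussian_disintegration_conditional[OF M, of G p, folded C\<nu>]
  have mean: "conditional_mean G m\<^sub>\<mu> C\<^sub>\<mu> p ys (G m\<^sub>\<mu> + C\<^sub>\<nu> g) = m\<^sub>\<mu> + C\<^sub>\<mu> (banach_adjoint G g)"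
    if "representing C\<^sub>\<nu> {1..p} ys" for ys g
    using gain_image_covariance[OF C that[unfolded C\<nu>], of g] by (simp add: conditional_mean_gain C\<nu>)
  show ?thesis
  proof (intro exI conjI allI impI)
    show "gaussian_disintegration \<mu> G (conditional_mean G m\<^sub>\<mu> C\<^sub>\<mu> p xs)
        (conditional_covariance G C\<^sub>\<mu> p xs)
        (\<lambda>y. distr \<mu> borel (\<lambda>x. unobserved G C\<^sub>\<mu> p xs x + gain G C\<^sub>\<mu> p xs y))"
      by (rule disint[OF xs])
    show "\<forall>y\<in>Y\<^sub>0. G (conditional_mean G m\<^sub>\<mu> C\<^sub>\<mu> p xs y) = y"
    proof -
      have "G (conditional_mean G m\<^sub>\<mu> C\<^sub>\<mu> p xs (G m\<^sub>\<mu> + C\<^sub>\<nu> g)) = G m\<^sub>\<mu> + C\<^sub>\<nu> g" for g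
        unfolding mean[OF xs] by (simp add: blinfun.add_right C\<nu>)
      then show ?thesis unfolding assms(6) by auto
    qed
    fix ys :: "nat \<Rightarrow> 'b \<Rightarrow>\<^sub>L real" assume ys: "representing C\<^sub>\<nu> {1..p} ys"
    show cov: "conditional_covariance G C\<^sub>\<mu> p xs = conditional_covariance G C\<^sub>\<mu> p ys"
      using xs ys unfolding C\<nu> by (rule conditional_covariance_unique[OF C])
    show "\<forall>y\<in>Y\<^sub>0. conditional_mean G m\<^sub>\<mu> C\<^sub>\<mu> p xs y = conditional_mean G m\<^sub>\<mu> C\<^sub>\<mu> p ys y"
      unfolding assms(6) by (auto simp: mean[OF xs] mean[OF ys])
    show "gaussian_disintegration \<mu> G (conditional_mean G m\<^sub>\<mu> C\<^sub>\<mu> p ys)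
        (conditional_covariance G C\<^sub>\<mu> p xs)
        (\<lambda>y. distr \<mu> borel (\<lambda>x. unobserved G C\<^sub>\<mu> p ys x + gain G C\<^sub>\<mu> p ys y))"
      unfolding cov by (rule disint[OF ys])
  qed
qed

end
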